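(* Let $(\mathcal{B},\mathbb{E},\mathfrak{s})$ be an extriangulated category with enough projectives and enough injectives. Suppose $((\mathcal{S},\mathcal{T}),(\mathcal{U},\mathcal{V}))$ is a twin cotorsion pair on $\mathcal{B}$ that satisfies $\mathcal{T}=\mathcal{U}$. Let $\mathcal{R}$ denote the class of regular morphisms in the heart $\overline{\mathcal{H}}$ of $((\mathcal{S},\mathcal{T}),(\mathcal{U},\mathcal{V}))$. Then the Gabriel--Zisman localisation $\overline{\mathcal{H}}_{\mathcal{R}}$ of $\overline{\mathcal{H}}$ at $\mathcal{R}$ is equivalent (as a category) to the heart $\overline{\mathscr{H}}_{(\mathcal{S},\mathcal{T})}$ of the single cotorsion pair $(\mathcal{S},\mathcal{T})$.
   Context: **Extriangulated categories (Nakaoka--Palu).** Let $\mathcal{B}$ be an additive category and $\mathbb{E}\colon\mathcal{B}^{\mathrm{op}}\times\mathcal{B}\to\mathsf{Ab}$ a biadditive functor. An element $\delta\in\mathbb{E}(C,A)$ is an extension. For $f\colon A\to X$ and $g\colon Y\to C$ put $f_*\delta=\mathbb{E}(C,f)(\delta)\in\mathbb{E}(C,X)$ and $g^*\delta=\mathbb{E}(g,A)(\delta)\in\mathbb{E}(Y,A)$. A morphism of extensions from $\delta\in\mathbb{E}(C,A)$ to $\delta'\in\mathbb{E}(D,B)$ is a pair $(f\colon A\to B,\,h\colon C\to D)$ with $f_*\delta=h^*\delta'$. Two sequences $A\xrightarrow{a}B\xrightarrow{b}C$ and $A\xrightarrow{a'}B'\xrightarrow{b'}C$ are equivalent if there is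 an isomorphism $g\colon B\to B'$ with $ga=a'$ and $b'g=b$; $[A\xrightarrow{a}B\xrightarrow{b}C]$ denotes the equivalence class. Let $\mathfrak{s}$ assign to each extension $\delta\in\mathbb{E}(C,A)$ an equivalence class $\mathfrak{s}(\delta)=[A\xrightarrow{a}B\xrightarrow{b}C]$; one says that $\delta$ is realised by $A\xrightarrow{a}B\xrightarrow{b}C$. $\mathfrak{s}$ is a realisation of $\mathbb{E}$ if, whenever $\mathfrak{s}(\delta)=[A\xrightarrow{a}B\xrightarrow{b}C]$, $\mathfrak{s}(\delta')=[A'\xrightarrow{a'}B'\xrightarrow{b'}C']$ and $(f,h)\colon\delta\to\delta'$ is a morphism of extensions, there is $g\colon B\to B'$ with $ga=a'f$ and $b'g=hb$ (then $(f,g,h)$ realises $(f,h)$). It is additive if (i) $0\in\mathbb{E}(C,A)$ is realised by the split sequence $A\to A\oplus C\to C$ for all $A,C$, and (ii) if $\delta\in\mathbb{E}(C,A)$ and $\delta'\in\mathbb{E}(C',A')$ are realised by $A\xrightarrow{a}B\xrightarrow{b}C$ and $A'\xrightarrow{a'}B'\xrightarrow{b'}C'$ respectively, then $\delta\oplus\delta'=(i_A)_*(p_C)^*\delta+(i_{A'})_*(p_{C'})^*\delta'\in\mathbb{E}(C\oplus C',A\oplus A')$ is realised by $A\oplus A'\xrightarrow{a\oplus a'}B\oplus B'\xrightarrow{b\oplus b'}C\oplus C'$, where $i$ and $p$ denote the canonical inclusions and projections. $(\mathcal{B},\mathbb{E},\mathfrak{s})$ is an extriangulated category if: (ET1) $\mathbb{E}$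 is biadditive; (ET2) $\mathfrak{s}$ is an additive realisation of $\mathbb{E}$; (ET3) if $\mathfrak{s}(\delta)=[A\xrightarrow{a}B\xrightarrow{b}C]$, $\mathfrak{s}(\delta')=[A'\xrightarrow{a'}B'\xrightarrow{b'}C']$ and $f\colon A\to A'$, $g\colon B\to B'$ satisfy $ga=a'f$, then there is $h\colon C\to C'$ with $f_*\delta=h^*\delta'$ and $hb=b'g$; (ET3$^{\mathrm{op}}$) dually, if $g\colon B\to B'$, $h\colon C\to C'$ satisfy $hb=b'g$, then there is $f\colon A\to A'$ with $f_*\delta=h^*\delta'$ and $ga=a'f$; (ET4) if $\delta\in\mathbb{E}(D,A)$ and $\delta'\in\mathbb{E}(F,B)$ are realised by $A\xrightarrow{a}B\xrightarrow{a'}D$ and $B\xrightarrow{b}C\xrightarrow{b'}F$, then there are an object $E$, an extension $\delta''\in\mathbb{E}(E,A)$ realised by $A\xrightarrow{c}C\xrightarrow{c'}E$, and morphisms $d\colon D\to E$, $e\colon E\to F$ with $c=ba$, $c'b=da'$, $ec'=b'$, $\mathfrak{s}((a')_*\delta')=[D\xrightarrow{d}E\xrightarrow{e}F]$, $d^*\delta''=\delta$ and $a_*\delta''=e^*\delta'$; (ET4$^{\mathrm{op}}$) the dual of (ET4). A conflation is a sequence $A\to B\to C$ that realises some extension in $\mathbb{E}(C,A)$. **Projectives and injectives.** An object $P\in\mathcal{B}$ is projective if for every conflation $A\to B\xrightarrow{b}C$ and every $c\colon P\to C$ there is $d\colon P\to B$ with $bd=c$. $\mathcal{B}$ has enough projectives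 if for every $C\in\mathcal{B}$ there is a conflation $A\to P\to C$ with $P$ projective. Injective objects and having enough injectives are defined dually. **Twin cotorsion pairs.** For full subcategories $\mathcal{X},\mathcal{Y}$ of $\mathcal{B}$ closed under isomorphisms: $\operatorname{Cone}(\mathcal{Y},\mathcal{X})$ is the full subcategory of objects $Z$ admitting a conflation $Y\to X\to Z$ with $X\in\mathcal{X}$, $Y\in\mathcal{Y}$; $\operatorname{CoCone}(\mathcal{Y},\mathcal{X})$ is the full subcategory of objects $Z$ admitting a conflation $Z\to Y\to X$ with $X\in\mathcal{X}$, $Y\in\mathcal{Y}$. A pair $(\mathcal{U},\mathcal{V})$ of full additive subcategories closed under direct summands is a cotorsion pair on $\mathcal{B}$ if $\mathbb{E}(\mathcal{U},\mathcal{V})=0$ (i.e. $\mathbb{E}(U,V)=0$ for all $U\in\mathcal{U}$, $V\in\mathcal{V}$) and $\mathcal{B}=\operatorname{Cone}(\mathcal{V},\mathcal{U})=\operatorname{CoCone}(\mathcal{V},\mathcal{U})$. If $(\mathcal{S},\mathcal{T})$ and $(\mathcal{U},\mathcal{V})$ are cotorsion pairs on $\mathcal{B}$, then $((\mathcal{S},\mathcal{T}),(\mathcal{U},\mathcal{V}))$ is a twin cotorsion pair on $\mathcal{B}$ if $\mathbb{E}(\mathcal{S},\mathcal{V})=0$ (equivalently $\mathcal{S}\subseteq\mathcal{U}$, equivalently $\mathcal{V}\subseteq\mathcal{T}$). **Hearts.** For a twin cotorsion pair $((\mathcal{S},\mathcal{T}),(\mathcal{U},\mathcal{V}))$ define full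 subcategories $\mathcal{W}=\mathcal{T}\cap\mathcal{U}$, $\mathcal{B}^-=\operatorname{CoCone}(\mathcal{W},\mathcal{S})$, $\mathcal{B}^+=\operatorname{Cone}(\mathcal{V},\mathcal{W})$, $\mathcal{H}=\mathcal{B}^-\cap\mathcal{B}^+$. $[\mathcal{W}]$ is the ideal of morphisms factoring through an object of $\mathcal{W}$. The heart is the additive quotient $\overline{\mathcal{H}}=\mathcal{H}/[\mathcal{W}]$ (objects of $\mathcal{H}$, morphism groups $\mathcal{B}(X,Y)/[\mathcal{W}](X,Y)$). When $\mathcal{T}=\mathcal{U}$ one has $\mathcal{W}=\mathcal{T}=\mathcal{U}$, $\mathcal{B}^-=\mathcal{B}^+=\mathcal{B}$ and $\overline{\mathcal{H}}=\mathcal{B}/[\mathcal{W}]$. The heart $\overline{\mathscr{H}}_{(\mathcal{S},\mathcal{T})}$ of a single cotorsion pair $(\mathcal{S},\mathcal{T})$ is the heart of the degenerate twin cotorsion pair $((\mathcal{S},\mathcal{T}),(\mathcal{S},\mathcal{T}))$; in the situation $\mathcal{T}=\mathcal{U}$ (so that $\mathcal{S}\subseteq\mathcal{T}$) it equals $\operatorname{CoCone}(\mathcal{S},\mathcal{S})/[\mathcal{S}]$. **Localisation.** A morphism is regular if it is both a monomorphism and an epimorphism. The Gabriel--Zisman localisation $\overline{\mathcal{H}}_{\mathcal{R}}$ is the category obtained from $\overline{\mathcal{H}}$ by universally (formally) inverting the morphisms in $\mathcal{R}$. *)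

theory Defs
  imports "HOL-Algebra.Coset"
begin

section \<open>Categories, functors, equivalences\<close>

record ('o, 'm) category =
  Obj :: "'o set"
  Arr :: "'m set"
  Dom :: "'m \<Rightarrow> 'o"
  Cod :: "'m \<Rightarrow> 'o"
  Ide :: "'o \<Rightarrow> 'm"
  Comp :: "'m \<Rightarrow> 'm \<Rightarrow> 'm"  (infixl "\<star>\<index>" 70)

definition Hom :: "('o, 'm, 'z) category_scheme \<Rightarrow> 'o \<Rightarrow> 'o \<Rightarrow> 'm set" where
  "Hom C X Y = {f \<in> Arr C. Dom C f = X \<and> Cod C f = Y}"

locale category =
  fixes C :: "('o, 'm, 'z) category_scheme" (structure)
  assumes dom_in_Obj: "f \<in> Arr C \<Longrightarrow> Dom C f \<in> Obj C"
    and cod_in_Obj: "f \<in> Arr C \<Longrightarrow> Cod C f \<in> Obj C"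
    and ide_in_Hom: "X \<in> Obj C \<Longrightarrow> Ide C X \<in> Hom C X X"
    and comp_in_Hom: "\<lbrakk>f \<in> Hom C X Y; g \<in> Hom C Y Z\<rbrakk> \<Longrightarrow> g \<star> f \<in> Hom C X Z"
    and comp_ide_right: "f \<in> Hom C X Y \<Longrightarrow> f \<star> Ide C X = f"
    and comp_ide_left: "f \<in> Hom C X Y \<Longrightarrow> Ide C Y \<star> f = f"
    and comp_assoc: "\<lbrakk>f \<in> Hom C W X; g \<in> Hom C X Y; h \<in> Hom C Y Z\<rbrakk>
          \<Longrightarrow> (h \<star> g) \<star> f = h \<star> (g \<star> f)"

definition isomorphism :: "('o, 'm, 'z) category_scheme \<Rightarrow> 'm \<Rightarrow> bool" where
  "isomorphism C f \<longleftrightarrow> f \<in> Arr C \<and>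
     (\<exists>g \<in> Hom C (Cod C f) (Dom C f).
        g \<star>\<^bsub>C\<^esub> f = Ide C (Dom C f) \<and> f \<star>\<^bsub>C\<^esub> g = Ide C (Cod C f))"

definition monomorphism :: "('o, 'm, 'z) category_scheme \<Rightarrow> 'm \<Rightarrow> bool" where
  "monomorphism C f \<longleftrightarrow> f \<in> Arr C \<and>
     (\<forall>X \<in> Obj C. \<forall>g \<in> Hom C X (Dom C f). \<forall>h \<in> Hom C X (Dom C f).
        f \<star>\<^bsub>C\<^esub> g = f \<star>\<^bsub>C\<^esub> h \<longrightarrow> g = h)"

definition epimorphism :: "('o, 'm, 'z) category_scheme \<Rightarrow> 'm \<Rightarrow> bool" where
  "epimorphism C f \<longleftrightarrow> f \<in> Arr C \<and>
     (\<forall>Y \<in> Obj C. \<forall>g \<in> Hom C (Cod C f) Y. \<forall>h \<in> Hom C (Cod C f) Y.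
        g \<star>\<^bsub>C\<^esub> f = h \<star>\<^bsub>C\<^esub> f \<longrightarrow> g = h)"

definition regular_morphisms :: "('o, 'm, 'z) category_scheme \<Rightarrow> 'm set" where
  "regular_morphisms C = {f. monomorphism C f \<and> epimorphism C f}"

definition is_functor ::
  "('o, 'm, 'z) category_scheme \<Rightarrow> ('p, 'n, 'y) category_scheme \<Rightarrow>
   ('o \<Rightarrow> 'p) \<Rightarrow> ('m \<Rightarrow> 'n) \<Rightarrow> bool" where
  "is_functor C D Fo Fm \<longleftrightarrow>
     (\<forall>X \<in> Obj C. Fo X \<in> Obj D) \<and>
     (\<forall>f \<in> Arr C. Fm f \<in> Hom D (Fo (Dom C f)) (Fo (Cod C f))) \<and>
     (\<forall>X \<in> Obj C. Fm (Ide C X) = Ide D (Fo X)) \<and>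
     (\<forall>f \<in> Arr C. \<forall>g \<in> Arr C. Cod C f = Dom C g \<longrightarrow>
        Fm (g \<star>\<^bsub>C\<^esub> f) = Fm g \<star>\<^bsub>D\<^esub> Fm f)"

definition natural_isomorphism ::
  "('o, 'm, 'z) category_scheme \<Rightarrow> ('p, 'n, 'y) category_scheme \<Rightarrow>
   ('o \<Rightarrow> 'p) \<Rightarrow> ('m \<Rightarrow> 'n) \<Rightarrow> ('o \<Rightarrow> 'p) \<Rightarrow> ('m \<Rightarrow> 'n) \<Rightarrow> ('o \<Rightarrow> 'n) \<Rightarrow> bool" where
  "natural_isomorphism C D Fo Fm Go Gm \<eta> \<longleftrightarrow>
     (\<forall>X \<in> Obj C. \<eta> X \<in> Hom D (Fo X) (Go X) \<and> isomorphism D (\<eta> X)) \<and>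
     (\<forall>f \<in> Arr C. \<eta> (Cod C f) \<star>\<^bsub>D\<^esub> Fm f = Gm f \<star>\<^bsub>D\<^esub> \<eta> (Dom C f))"

definition equivalent_categories ::
  "('o, 'm, 'z) category_scheme \<Rightarrow> ('p, 'n, 'y) category_scheme \<Rightarrow> bool" where
  "equivalent_categories C D \<longleftrightarrow>
     category C \<and> category D \<and>
     (\<exists>Fo Fm Go Gm \<eta> \<epsilon>.
        is_functor C D Fo Fm \<and> is_functor D C Go Gm \<and>
        natural_isomorphism C C id id (Go \<circ> Fo) (Gm \<circ> Fm) \<eta> \<and>
        natural_isomorphism D D (Fo \<circ> Go) (Fm \<circ> Gm) id id \<epsilon>)"

definition full_subcategory ::
  "('o, 'm, 'z) category_scheme \<Rightarrow> 'o set \<Rightarrow> ('o, 'm, 'z) category_scheme" where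
  "full_subcategory C H =
     C\<lparr>Obj := H, Arr := {f \<in> Arr C. Dom C f \<in> H \<and> Cod C f \<in> H}\<rparr>"


section \<open>Additive categories and additive quotients\<close>

record ('o, 'm) preadditive = "('o, 'm) category" +
  Add :: "'m \<Rightarrow> 'm \<Rightarrow> 'm"  (infixl "\<boxplus>\<index>" 65)
  Zero :: "'o \<Rightarrow> 'o \<Rightarrow> 'm"

definition hom_group :: "('o, 'm, 'z) preadditive_scheme \<Rightarrow> 'o \<Rightarrow> 'o \<Rightarrow> 'm monoid" where
  "hom_group C X Y = \<lparr>carrier = Hom C X Y, mult = Add C, one = Zero C X Y\<rparr>"

locale preadditive_category = category C
  for C :: "('o, 'm, 'z) preadditive_scheme" (structure) +
  assumes hom_comm_group: "\<lbrakk>X \<in> Obj C; Y \<in> Obj C\<rbrakk> \<Longrightarrow> comm_group (hom_group C X Y)"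
    and comp_add_left: "\<lbrakk>f \<in> Hom C X Y; g \<in> Hom C Y Z; g' \<in> Hom C Y Z\<rbrakk>
          \<Longrightarrow> (g \<boxplus> g') \<star> f = (g \<star> f) \<boxplus> (g' \<star> f)"
    and comp_add_right: "\<lbrakk>f \<in> Hom C X Y; f' \<in> Hom C X Y; g \<in> Hom C Y Z\<rbrakk>
          \<Longrightarrow> g \<star> (f \<boxplus> f') = (g \<star> f) \<boxplus> (g \<star> f')"

definition zero_object :: "('o, 'm, 'z) category_scheme \<Rightarrow> 'o \<Rightarrow> bool" where
  "zero_object C Z \<longleftrightarrow> Z \<in> Obj C \<and>
     (\<forall>X \<in> Obj C. (\<exists>!f. f \<in> Hom C X Z) \<and> (\<exists>!f. f \<in> Hom C Z X))"

text \<open>\<open>P\<close>, with inclusions \<open>i, i'\<close> and projections \<open>p, p'\<close>, is a direct sum of \<open>A\<close> and \<open>A'\<close>.\<close>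

definition biproduct ::
  "('o, 'm, 'z) preadditive_scheme \<Rightarrow> 'o \<Rightarrow> 'o \<Rightarrow> 'o \<Rightarrow> 'm \<Rightarrow> 'm \<Rightarrow> 'm \<Rightarrow> 'm \<Rightarrow> bool" where
  "biproduct C A A' P i i' p p' \<longleftrightarrow>
     A \<in> Obj C \<and> A' \<in> Obj C \<and> P \<in> Obj C \<and>
     i \<in> Hom C A P \<and> i' \<in> Hom C A' P \<and> p \<in> Hom C P A \<and> p' \<in> Hom C P A' \<and>
     p \<star>\<^bsub>C\<^esub> i = Ide C A \<and> p' \<star>\<^bsub>C\<^esub> i' = Ide C A' \<and>
     p \<star>\<^bsub>C\<^esub> i' = Zero C A' A \<and> p' \<star>\<^bsub>C\<^esub> i = Zero C A A' \<and>
     (i \<star>\<^bsub>C\<^esub> p) \<boxplus>\<^bsub>C\<^esub> (i' \<star>\<^bsub>C\<^esub> p') = Ide C P"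

locale additive_category = preadditive_category C
  for C :: "('o, 'm, 'z) preadditive_scheme" (structure) +
  assumes has_zero_object: "\<exists>Z. zero_object C Z"
    and has_biproducts: "\<lbrakk>A \<in> Obj C; A' \<in> Obj C\<rbrakk> \<Longrightarrow> \<exists>P i i' p p'. biproduct C A A' P i i' p p'"

text \<open>Full subcategories closed under isomorphisms are represented by their sets of objects.\<close>

definition iso_closed :: "('o, 'm, 'z) category_scheme \<Rightarrow> 'o set \<Rightarrow> bool" where
  "iso_closed C U \<longleftrightarrow> U \<subseteq> Obj C \<and>
     (\<forall>f. isomorphism C f \<and> Dom C f \<in> U \<longrightarrow> Cod C f \<in> U)"

definition additive_subcategory :: "('o, 'm, 'z) preadditive_scheme \<Rightarrow> 'o set \<Rightarrow> bool" where
  "additive_subcategory C U \<longleftrightarrow> iso_closed C U \<and>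
     (\<exists>Z \<in> U. zero_object C Z) \<and>
     (\<forall>A A' P i i' p p'.
        biproduct C A A' P i i' p p' \<and> A \<in> U \<and> A' \<in> U \<longrightarrow> P \<in> U)"

definition summand_closed :: "('o, 'm, 'z) preadditive_scheme \<Rightarrow> 'o set \<Rightarrow> bool" where
  "summand_closed C U \<longleftrightarrow>
     (\<forall>A A' P i i' p p'.
        biproduct C A A' P i i' p p' \<and> P \<in> U \<longrightarrow> A \<in> U \<and> A' \<in> U)"

definition factoring_ideal ::
  "('o, 'm, 'z) category_scheme \<Rightarrow> 'o set \<Rightarrow> 'o \<Rightarrow> 'o \<Rightarrow> 'm set" where
  "factoring_ideal C W X Y = {v \<star>\<^bsub>C\<^esub> u | u v Z. Z \<in> W \<and> u \<in> Hom C X Z \<and> v \<in> Hom C Z Y}"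

text \<open>
  The quotient of a preadditive category by a two-sided ideal \<open>I\<close> of morphisms. The group of
  morphisms from \<open>X\<close> to \<open>Y\<close> is the HOL-Algebra quotient \<open>hom_group C X Y Mod I X Y\<close>, so morphisms
  are cosets; all members of such a coset have the same domain and codomain, and the structure is
  computed on an arbitrary representative.
\<close>

definition additive_quotient ::
  "('o, 'm, 'z) preadditive_scheme \<Rightarrow> ('o \<Rightarrow> 'o \<Rightarrow> 'm set) \<Rightarrow> ('o, 'm set) preadditive" where
  "additive_quotient C I =
     (let rep = (\<lambda>F. SOME f. f \<in> F);
          coset = (\<lambda>f. I (Dom C f) (Cod C f) #>\<^bsub>hom_group C (Dom C f) (Cod C f)\<^esub> f)
      in \<lparr>Obj = Obj C,
          Arr = (\<Union>X \<in> Obj C. \<Union>Y \<in> Obj C. carrier (hom_group C X Y Mod I X Y)),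
          Dom = (\<lambda>F. Dom C (rep F)),
          Cod = (\<lambda>F. Cod C (rep F)),
          Ide = (\<lambda>X. coset (Ide C X)),
          Comp = (\<lambda>G F. coset (rep G \<star>\<^bsub>C\<^esub> rep F)),
          Add = (\<lambda>F G. F <#>\<^bsub>hom_group C (Dom C (rep F)) (Cod C (rep F))\<^esub> G),
          Zero = I\<rparr>)"


section \<open>Gabriel--Zisman localisation\<close>

text \<open>
  Morphisms of the localisation of \<open>C\<close> at \<open>R\<close> are zigzags of morphisms of \<open>C\<close> and formal inverses of
  morphisms in \<open>R\<close>, modulo the smallest congruence that identifies composites and identities with
  those of \<open>C\<close> and makes the formal inverses inverse. Steps of a zigzag are listed in the order in
  which they are traversed.
\<close>

datatype 'm step = Forward 'm | Backward 'm

primrec step_dom :: "('o, 'm, 'z) category_scheme \<Rightarrow> 'm step \<Rightarrow> 'o" where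
  "step_dom C (Forward f) = Dom C f"
| "step_dom C (Backward r) = Cod C r"

primrec step_cod :: "('o, 'm, 'z) category_scheme \<Rightarrow> 'm step \<Rightarrow> 'o" where
  "step_cod C (Forward f) = Cod C f"
| "step_cod C (Backward r) = Dom C r"

primrec zigzag ::
  "('o, 'm, 'z) category_scheme \<Rightarrow> 'm set \<Rightarrow> 'o \<Rightarrow> 'm step list \<Rightarrow> 'o \<Rightarrow> bool" where
  "zigzag C R X [] Y \<longleftrightarrow> X \<in> Obj C \<and> X = Y"
| "zigzag C R X (s # ss) Y \<longleftrightarrow>
     s \<in> Forward ` Arr C \<union> Backward ` R \<and> step_dom C s = X \<and> zigzag C R (step_cod C s) ss Y"

inductive zigzag_eq ::
  "('o, 'm, 'z) category_scheme \<Rightarrow> 'm set \<Rightarrow> 'o \<Rightarrow> 'o \<Rightarrow> 'm step list \<Rightarrow> 'm step list \<Rightarrow> bool"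
  for C :: "('o, 'm, 'z) category_scheme" and R :: "'m set" where
  zz_refl: "zigzag C R X ss Y \<Longrightarrow> zigzag_eq C R X Y ss ss"
| zz_sym: "zigzag_eq C R X Y ss ts \<Longrightarrow> zigzag_eq C R X Y ts ss"
| zz_trans: "\<lbrakk>zigzag_eq C R X Y ss ts; zigzag_eq C R X Y ts us\<rbrakk> \<Longrightarrow> zigzag_eq C R X Y ss us"
| zz_append: "\<lbrakk>zigzag_eq C R X Y ss ss'; zigzag_eq C R Y Z ts ts'\<rbrakk>
    \<Longrightarrow> zigzag_eq C R X Z (ss @ ts) (ss' @ ts')"
| zz_ide: "X \<in> Obj C \<Longrightarrow> zigzag_eq C R X X [Forward (Ide C X)] []"
| zz_comp: "\<lbrakk>f \<in> Hom C X Y; g \<in> Hom C Y Z\<rbrakk>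
    \<Longrightarrow> zigzag_eq C R X Z [Forward f, Forward g] [Forward (g \<star>\<^bsub>C\<^esub> f)]"
| zz_inv1: "r \<in> R \<Longrightarrow> zigzag_eq C R (Dom C r) (Dom C r) [Forward r, Backward r] []"
| zz_inv2: "r \<in> R \<Longrightarrow> zigzag_eq C R (Cod C r) (Cod C r) [Backward r, Forward r] []"

definition zigzag_class ::
  "('o, 'm, 'z) category_scheme \<Rightarrow> 'm set \<Rightarrow> 'o \<Rightarrow> 'm step list \<Rightarrow> 'o \<Rightarrow>
   'o \<times> 'm step list set \<times> 'o" where
  "zigzag_class C R X ss Y = (X, {ts. zigzag_eq C R X Y ss ts}, Y)"

definition localisation ::
  "('o, 'm, 'z) category_scheme \<Rightarrow> 'm set \<Rightarrow> ('o, 'o \<times> 'm step list set \<times> 'o) category" where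
  "localisation C R =
     \<lparr>Obj = Obj C,
      Arr = {zigzag_class C R X ss Y | X ss Y. zigzag C R X ss Y},
      Dom = (\<lambda>(X, P, Y). X),
      Cod = (\<lambda>(X, P, Y). Y),
      Ide = (\<lambda>X. zigzag_class C R X [] X),
      Comp = (\<lambda>(Y', Q, Z) (X, P, Y).
                (X, {us. \<exists>ss \<in> P. \<exists>ts \<in> Q. zigzag_eq C R X Z (ss @ ts) us}, Z))\<rparr>"


section \<open>Extriangulated categories\<close>

text \<open>
  The bifunctor \<open>\<E> : B\<^sup>o\<^sup>p \<times> B \<rightarrow> Ab\<close> is given by the groups \<open>Ext C A\<close> (written multiplicatively, as
  all groups of HOL-Algebra) and by the maps \<open>ExtMap g f : Ext C A \<rightarrow> Ext Y X\<close> for \<open>g : Y \<rightarrow> C\<close> and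
  \<open>f : A \<rightarrow> X\<close>. The field \<open>Realise C A \<delta>\<close> is the class of sequences that \<open>\<ss>\<close> assigns to \<open>\<delta> \<in> Ext C A\<close>.
\<close>

record ('o, 'm, 'e) extriangulated = "('o, 'm) preadditive" +
  Ext :: "'o \<Rightarrow> 'o \<Rightarrow> 'e monoid"
  ExtMap :: "'m \<Rightarrow> 'm \<Rightarrow> 'e \<Rightarrow> 'e"
  Realise :: "'o \<Rightarrow> 'o \<Rightarrow> 'e \<Rightarrow> ('m \<times> 'm) set"

text \<open>\<open>push B C f \<delta>\<close> is \<open>f\<^sub>* \<delta>\<close> for \<open>\<delta> \<in> Ext C A\<close>, and \<open>pull B A g \<delta>\<close> is \<open>g\<^sup>* \<delta>\<close>.\<close>

definition push ::
  "('o, 'm, 'e, 'z) extriangulated_scheme \<Rightarrow> 'o \<Rightarrow> 'm \<Rightarrow> 'e \<Rightarrow> 'e" where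
  "push B C f \<delta> = ExtMap B (Ide B C) f \<delta>"

definition pull ::
  "('o, 'm, 'e, 'z) extriangulated_scheme \<Rightarrow> 'o \<Rightarrow> 'm \<Rightarrow> 'e \<Rightarrow> 'e" where
  "pull B A g \<delta> = ExtMap B g (Ide B A) \<delta>"

locale biadditive_bifunctor = additive_category B
  for B :: "('o, 'm, 'e, 'z) extriangulated_scheme" (structure) +
  assumes ext_comm_group: "\<lbrakk>C \<in> Obj B; A \<in> Obj B\<rbrakk> \<Longrightarrow> comm_group (Ext B C A)"
    and ext_map_hom: "\<lbrakk>g \<in> Hom B Y C; f \<in> Hom B A X\<rbrakk>
          \<Longrightarrow> ExtMap B g f \<in> hom (Ext B C A) (Ext B Y X)"
    and ext_map_ide: "\<lbrakk>C \<in> Obj B; A \<in> Obj B; \<delta> \<in> carrier (Ext B C A)\<rbrakk>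
          \<Longrightarrow> ExtMap B (Ide B C) (Ide B A) \<delta> = \<delta>"
    and ext_map_comp: "\<lbrakk>g \<in> Hom B Y C; g' \<in> Hom B Y' Y; f \<in> Hom B A X; f' \<in> Hom B X X';
            \<delta> \<in> carrier (Ext B C A)\<rbrakk>
          \<Longrightarrow> ExtMap B (g \<star> g') (f' \<star> f) \<delta> = ExtMap B g' f' (ExtMap B g f \<delta>)"
    and ext_map_add_left: "\<lbrakk>g \<in> Hom B Y C; g' \<in> Hom B Y C; f \<in> Hom B A X;
            \<delta> \<in> carrier (Ext B C A)\<rbrakk>
          \<Longrightarrow> ExtMap B (g \<boxplus> g') f \<delta> = ExtMap B g f \<delta> \<otimes>\<^bsub>Ext B Y X\<^esub> ExtMap B g' f \<delta>"
    and ext_map_add_right: "\<lbrakk>g \<in> Hom B Y C; f \<in> Hom B A X; f' \<in> Hom B A X;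
            \<delta> \<in> carrier (Ext B C A)\<rbrakk>
          \<Longrightarrow> ExtMap B g (f \<boxplus> f') \<delta> = ExtMap B g f \<delta> \<otimes>\<^bsub>Ext B Y X\<^esub> ExtMap B g f' \<delta>"

definition seqs :: "('o, 'm, 'z) category_scheme \<Rightarrow> 'o \<Rightarrow> 'o \<Rightarrow> ('m \<times> 'm) set" where
  "seqs B A C = {(a, b). \<exists>Y \<in> Obj B. a \<in> Hom B A Y \<and> b \<in> Hom B Y C}"

definition seq_equiv ::
  "('o, 'm, 'z) category_scheme \<Rightarrow> 'o \<Rightarrow> 'o \<Rightarrow> (('m \<times> 'm) \<times> ('m \<times> 'm)) set" where
  "seq_equiv B A C =
     {((a, b), (a', b')). (a, b) \<in> seqs B A C \<and> (a', b') \<in> seqs B A C \<and>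
        (\<exists>g \<in> Hom B (Cod B a) (Cod B a').
           isomorphism B g \<and> g \<star>\<^bsub>B\<^esub> a = a' \<and> b' \<star>\<^bsub>B\<^esub> g = b)}"

definition realised ::
  "('o, 'm, 'e, 'z) extriangulated_scheme \<Rightarrow> 'e \<Rightarrow> 'o \<Rightarrow> 'm \<Rightarrow> 'o \<Rightarrow> 'm \<Rightarrow> 'o \<Rightarrow> bool" where
  "realised B \<delta> A a Y b C \<longleftrightarrow>
     A \<in> Obj B \<and> Y \<in> Obj B \<and> C \<in> Obj B \<and> \<delta> \<in> carrier (Ext B C A) \<and>
     a \<in> Hom B A Y \<and> b \<in> Hom B Y C \<and> Realise B C A \<delta> = seq_equiv B A C `` {(a, b)}"

definition conflation ::
  "('o, 'm, 'e, 'z) extriangulated_scheme \<Rightarrow> 'o \<Rightarrow> 'm \<Rightarrow> 'o \<Rightarrow> 'm \<Rightarrow> 'o \<Rightarrow> bool" where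
  "conflation B A a Y b C \<longleftrightarrow> (\<exists>\<delta> \<in> carrier (Ext B C A). realised B \<delta> A a Y b C)"

locale additive_realisation = biadditive_bifunctor B
  for B :: "('o, 'm, 'e, 'z) extriangulated_scheme" (structure) +
  assumes real_class: "\<lbrakk>C \<in> Obj B; A \<in> Obj B; \<delta> \<in> carrier (Ext B C A)\<rbrakk>
          \<Longrightarrow> Realise B C A \<delta> \<in> seqs B A C // seq_equiv B A C"
    and real_morphism:
        "\<lbrakk>realised B \<delta> A a Y b C; realised B \<delta>' A' a' Y' b' C';
          f \<in> Hom B A A'; h \<in> Hom B C C'; push B C f \<delta> = pull B A' h \<delta>'\<rbrakk>
          \<Longrightarrow> \<exists>g \<in> Hom B Y Y'. g \<star> a = a' \<star> f \<and> b' \<star> g = h \<star> b"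
    and real_zero: "biproduct B A C P i i' p p' \<Longrightarrow> realised B \<one>\<^bsub>Ext B C A\<^esub> A i P p' C"
    and real_sum:
        "\<lbrakk>realised B \<delta> A a Y b C; realised B \<delta>' A' a' Y' b' C';
          biproduct B A A' PA iA iA' pA pA';
          biproduct B Y Y' PY iY iY' pY pY';
          biproduct B C C' PC iC iC' pC pC'\<rbrakk>
          \<Longrightarrow> realised B
                (push B PC iA (pull B A pC \<delta>) \<otimes>\<^bsub>Ext B PC PA\<^esub> push B PC iA' (pull B A' pC' \<delta>'))
                PA ((iY \<star> a \<star> pA) \<boxplus> (iY' \<star> a' \<star> pA'))
                PY ((iC \<star> b \<star> pY) \<boxplus> (iC' \<star> b' \<star> pY')) PC"

locale extriangulated_category = additive_realisation B
  for B :: "('o, 'm, 'e, 'z) extriangulated_scheme" (structure) +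
  assumes ET3:
        "\<lbrakk>realised B \<delta> A a Y b C; realised B \<delta>' A' a' Y' b' C';
          f \<in> Hom B A A'; g \<in> Hom B Y Y'; g \<star> a = a' \<star> f\<rbrakk>
          \<Longrightarrow> \<exists>h \<in> Hom B C C'. push B C f \<delta> = pull B A' h \<delta>' \<and> h \<star> b = b' \<star> g"
    and ET3_op:
        "\<lbrakk>realised B \<delta> A a Y b C; realised B \<delta>' A' a' Y' b' C';
          g \<in> Hom B Y Y'; h \<in> Hom B C C'; h \<star> b = b' \<star> g\<rbrakk>
          \<Longrightarrow> \<exists>f \<in> Hom B A A'. push B C f \<delta> = pull B A' h \<delta>' \<and> g \<star> a = a' \<star> f"
    and ET4:
        "\<lbrakk>realised B \<delta> A a Y a' D; realised B \<delta>' Y b C b' F\<rbrakk>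
          \<Longrightarrow> \<exists>E \<in> Obj B. \<exists>\<delta>'' \<in> carrier (Ext B E A).
                \<exists>c \<in> Hom B A C. \<exists>c' \<in> Hom B C E. \<exists>d \<in> Hom B D E. \<exists>e \<in> Hom B E F.
                realised B \<delta>'' A c C c' E \<and>
                c = b \<star> a \<and> c' \<star> b = d \<star> a' \<and> e \<star> c' = b' \<and>
                realised B (push B F a' \<delta>') D d E e F \<and>
                pull B A d \<delta>'' = \<delta> \<and> push B E a \<delta>'' = pull B Y e \<delta>'"
    and ET4_op:
        "\<lbrakk>realised B \<delta> D a' Y a A; realised B \<delta>' F b' C b Y\<rbrakk>
          \<Longrightarrow> \<exists>E \<in> Obj B. \<exists>\<delta>'' \<in> carrier (Ext B A E).
                \<exists>c \<in> Hom B C A. \<exists>c' \<in> Hom B E C. \<exists>d \<in> Hom B E D. \<exists>e \<in> Hom B F E.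
                realised B \<delta>'' E c' C c A \<and>
                c = a \<star> b \<and> b \<star> c' = a' \<star> d \<and> c' \<star> e = b' \<and>
                realised B (pull B F a' \<delta>') F e E d D \<and>
                push B A d \<delta>'' = \<delta> \<and> pull B E a \<delta>'' = push B Y e \<delta>'"

definition projective :: "('o, 'm, 'e, 'z) extriangulated_scheme \<Rightarrow> 'o \<Rightarrow> bool" where
  "projective B P \<longleftrightarrow> P \<in> Obj B \<and>
     (\<forall>A a Y b C. conflation B A a Y b C \<longrightarrow>
        (\<forall>c \<in> Hom B P C. \<exists>d \<in> Hom B P Y. b \<star>\<^bsub>B\<^esub> d = c))"

definition injective :: "('o, 'm, 'e, 'z) extriangulated_scheme \<Rightarrow> 'o \<Rightarrow> bool" where
  "injective B J \<longleftrightarrow> J \<in> Obj B \<and>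
     (\<forall>A a Y b C. conflation B A a Y b C \<longrightarrow>
        (\<forall>c \<in> Hom B A J. \<exists>d \<in> Hom B Y J. d \<star>\<^bsub>B\<^esub> a = c))"

definition enough_projectives :: "('o, 'm, 'e, 'z) extriangulated_scheme \<Rightarrow> bool" where
  "enough_projectives B \<longleftrightarrow>
     (\<forall>C \<in> Obj B. \<exists>A a P b. conflation B A a P b C \<and> projective B P)"

definition enough_injectives :: "('o, 'm, 'e, 'z) extriangulated_scheme \<Rightarrow> bool" where
  "enough_injectives B \<longleftrightarrow>
     (\<forall>A \<in> Obj B. \<exists>a J b C. conflation B A a J b C \<and> injective B J)"


section \<open>Twin cotorsion pairs and hearts\<close>

definition Cone :: "('o, 'm, 'e, 'z) extriangulated_scheme \<Rightarrow> 'o set \<Rightarrow> 'o set \<Rightarrow> 'o set" where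
  "Cone B \<Y> \<X> = {Z. \<exists>Y \<in> \<Y>. \<exists>X \<in> \<X>. \<exists>a b. conflation B Y a X b Z}"

definition CoCone :: "('o, 'm, 'e, 'z) extriangulated_scheme \<Rightarrow> 'o set \<Rightarrow> 'o set \<Rightarrow> 'o set" where
  "CoCone B \<Y> \<X> = {Z. \<exists>Y \<in> \<Y>. \<exists>X \<in> \<X>. \<exists>a b. conflation B Z a Y b X}"

definition ext_vanishes :: "('o, 'm, 'e, 'z) extriangulated_scheme \<Rightarrow> 'o set \<Rightarrow> 'o set \<Rightarrow> bool" where
  "ext_vanishes B \<X> \<Y> \<longleftrightarrow> (\<forall>X \<in> \<X>. \<forall>Y \<in> \<Y>. carrier (Ext B X Y) = {\<one>\<^bsub>Ext B X Y\<^esub>})"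

definition cotorsion_pair :: "('o, 'm, 'e, 'z) extriangulated_scheme \<Rightarrow> 'o set \<Rightarrow> 'o set \<Rightarrow> bool" where
  "cotorsion_pair B U V \<longleftrightarrow>
     additive_subcategory B U \<and> summand_closed B U \<and>
     additive_subcategory B V \<and> summand_closed B V \<and>
     ext_vanishes B U V \<and> Obj B = Cone B V U \<and> Obj B = CoCone B V U"

definition twin_cotorsion_pair ::
  "('o, 'm, 'e, 'z) extriangulated_scheme \<Rightarrow> 'o set \<Rightarrow> 'o set \<Rightarrow> 'o set \<Rightarrow> 'o set \<Rightarrow> bool" where
  "twin_cotorsion_pair B S T U V \<longleftrightarrow>
     cotorsion_pair B S T \<and> cotorsion_pair B U V \<and> ext_vanishes B S V"

definition heart_objects ::
  "('o, 'm, 'e, 'z) extriangulated_scheme \<Rightarrow> 'o set \<Rightarrow> 'o set \<Rightarrow> 'o set \<Rightarrow> 'o set \<Rightarrow> 'o set" where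
  "heart_objects B S T U V = CoCone B (T \<inter> U) S \<inter> Cone B V (T \<inter> U)"

definition heart ::
  "('o, 'm, 'e, 'z) extriangulated_scheme \<Rightarrow> 'o set \<Rightarrow> 'o set \<Rightarrow> 'o set \<Rightarrow> 'o set \<Rightarrow>
   ('o, 'm set) preadditive" where
  "heart B S T U V =
     additive_quotient (full_subcategory B (heart_objects B S T U V)) (factoring_ideal B (T \<inter> U))"

definition cotorsion_heart ::
  "('o, 'm, 'e, 'z) extriangulated_scheme \<Rightarrow> 'o set \<Rightarrow> 'o set \<Rightarrow> ('o, 'm set) preadditive" where
  "cotorsion_heart B S T = heart B S T S T"

end

theory Submission
  imports Defs
begin

text \<open>
  When $T = U$ the heart is the quotient of $B$ by the ideal of morphisms factoring through $T$. Put
  $K = \mathrm{CoCone}(S, S)$. Since $E(S, T) = 0$, a morphism out of an object of $K$ that factors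
  through $T$ already factors through $S$; hence $K/[S]$ is a full subcategory of $B/[T]$.
  Conflations $X \to T_0 \to S_0$ and $T_1 \to S_1 \to T_0$ yield, by (ET4$^{op}$), a conflation
  $T_1 \to E \to X$ with $E$ in $K$ whose deflation $E \to X$ is regular in $B/[T]$. Conversely,
  every regular morphism of $B/[T]$ induces bijections on morphisms out of objects of $K$. So $K/[S]$
  is coreflective in $B/[T]$ with regular counits, and the coreflector inverts the regular morphisms:
  it is the localisation.
\<close>

section \<open>Localisation at the counits of a coreflection\<close>

text \<open>A morphism of the localisation is a zigzag of arbitrary length, and no calculus of
  fractions is set up to shorten it. Unique lifting replaces one: morphisms out of an object of K
  lift uniquely along every regular morphism. So each step of a zigzag, forward or backward,
  determines one morphism between the coreflections of its ends, and the composite of these decides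
  when two zigzags with the same ends are equal.

  Uniqueness of the lifts is monicity. Existence needs the exact structure of B. Mono and epi are
  properties of a quotient that carries no conflations, so they are first restated as membership of
  morphisms of B in the ideal [T], and then used to make extension classes vanish through E(S, T) =
  0. Projectives supply the morphism on which monicity is tested: every class in E(C, X) is pushed
  out from the kernel of a projective cover of C.\<close>

lemma Hom_D: "f \<in> Hom C X Y \<Longrightarrow> f \<in> Arr C \<and> Dom C f = X \<and> Cod C f = Y"
  by (simp add: Hom_def)

lemma (in category) Hom_Obj: "f \<in> Hom C X Y \<Longrightarrow> X \<in> Obj C \<and> Y \<in> Obj C"
  using dom_in_Obj cod_in_Obj by (auto simp: Hom_def)

lemma (in category) isomorphismI:
  "\<lbrakk>f \<in> Hom C X Y; g \<in> Hom C Y X; g \<star> f = Ide C X; f \<star> g = Ide C Y\<rbrakk> \<Longrightarrow> isomorphism C f"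
  by (auto simp: isomorphism_def Hom_def)

lemma zigzag_append:
  "\<lbrakk>zigzag C R X ss Y; zigzag C R Y ts Z\<rbrakk> \<Longrightarrow> zigzag C R X (ss @ ts) Z"
  by (induction ss arbitrary: X) auto

section \<open>Zigzags modulo equality form a category\<close>

locale zigzag_category = category C
  for C :: "('o, 'm, 'z) category_scheme" (structure) and R :: "'m set" +
  assumes R_Arr: "R \<subseteq> Arr C"
begin

lemma zigzag_Obj: "zigzag C R X ss Y \<Longrightarrow> X \<in> Obj C \<and> Y \<in> Obj C"
  using R_Arr dom_in_Obj cod_in_Obj by (induction ss arbitrary: X) auto

lemma zigzag_Forward: "f \<in> Hom C X Y \<Longrightarrow> zigzag C R X [Forward f] Y"
  using cod_in_Obj by (auto simp: Hom_def)

lemma zigzag_Backward: "\<lbrakk>r \<in> R; Cod C r = X; Dom C r = Y\<rbrakk> \<Longrightarrow> zigzag C R X [Backward r] Y"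
  using dom_in_Obj R_Arr by auto

lemma zigzag_eq_imp_zigzag:
  "zigzag_eq C R X Y ss ts \<Longrightarrow> zigzag C R X ss Y \<and> zigzag C R X ts Y"
proof (induction rule: zigzag_eq.induct)
  case (zz_comp f X Y g Z)
  then have "g \<star> f \<in> Hom C X Z" by (rule comp_in_Hom)
  with zz_comp cod_in_Obj show ?case by (auto simp: Hom_def)
next
  case (zz_ide X)
  then show ?case using ide_in_Hom[of X] by (auto simp: Hom_def)
qed (use R_Arr dom_in_Obj cod_in_Obj in \<open>auto intro: zigzag_append\<close>)

text \<open>\<open>zigzag_eq\<close> is reflexive only on zigzags, so a list that is no zigzag has
  an empty class. The assumption on \<open>ss\<close> excludes the coincidence of two empty
  classes.\<close>

lemma zigzag_class_eq_iff:
  assumes "zigzag C R X ss Y"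
  shows "zigzag_class C R X ss Y = zigzag_class C R X' ts Y' \<longleftrightarrow>
    X = X' \<and> Y = Y' \<and> zigzag_eq C R X Y ss ts"
proof -
  have "{us. zigzag_eq C R X Y ss us} = {us. zigzag_eq C R X Y ts us} \<longleftrightarrow> zigzag_eq C R X Y ss ts"
  proof
    assume "{us. zigzag_eq C R X Y ss us} = {us. zigzag_eq C R X Y ts us}"
    then have "zigzag_eq C R X Y ts ss" using zz_refl[OF assms] by blast
    then show "zigzag_eq C R X Y ss ts" by (rule zz_sym)
  next
    assume "zigzag_eq C R X Y ss ts"
    then show "{us. zigzag_eq C R X Y ss us} = {us. zigzag_eq C R X Y ts us}"
      by (blast intro: zz_sym zz_trans)
  qed
  then show ?thesis unfolding zigzag_class_def by auto
qed

abbreviation Loc where "Loc \<equiv> localisation C R"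

lemma Loc_simps:
  "Obj Loc = Obj C" "Arr Loc = {zigzag_class C R X ss Y | X ss Y. zigzag C R X ss Y}"
  "Dom Loc (zigzag_class C R X ss Y) = X" "Cod Loc (zigzag_class C R X ss Y) = Y"
  "Ide Loc X = zigzag_class C R X [] X"
  by (simp_all add: localisation_def zigzag_class_def)

lemma Hom_Loc: "Hom Loc X Y = {zigzag_class C R X ss Y | ss. zigzag C R X ss Y}"
  unfolding Hom_def by (auto simp: Loc_simps)

text \<open>The definition of the composite ranges over all representatives. As
  \<open>zigzag_eq\<close> is a congruence for \<open>@\<close>, one pair of representatives gives
  the whole class.\<close>

lemma Comp_Loc:
  assumes "zigzag C R X ss Y" "zigzag C R Y ts Z"
  shows "zigzag_class C R Y ts Z \<star>\<^bsub>Loc\<^esub> zigzag_class C R X ss Y = zigzag_class C R X (ss @ ts) Z"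
proof -
  have "(\<exists>ss'. zigzag_eq C R X Y ss ss' \<and> (\<exists>ts'. zigzag_eq C R Y Z ts ts' \<and>
      zigzag_eq C R X Z (ss' @ ts') us)) \<longleftrightarrow> zigzag_eq C R X Z (ss @ ts) us" for us
    using zz_refl[OF assms(1)] zz_refl[OF assms(2)] by (meson zz_append zz_trans)
  then show ?thesis by (simp add: localisation_def zigzag_class_def Bex_def)
qed

lemma category_Loc: "category Loc"
proof
  fix f assume "f \<in> Arr Loc"
  then show "Dom Loc f \<in> Obj Loc" "Cod Loc f \<in> Obj Loc"
    using zigzag_Obj by (auto simp: Loc_simps)
next
  fix X assume "X \<in> Obj Loc"
  then show "Ide Loc X \<in> Hom Loc X X"
    unfolding Hom_Loc Loc_simps(5) by (force simp: Loc_simps)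
next
  fix f X Y g Z assume "f \<in> Hom Loc X Y" "g \<in> Hom Loc Y Z"
  then show "g \<star>\<^bsub>Loc\<^esub> f \<in> Hom Loc X Z"
    by (auto simp: Hom_Loc Comp_Loc intro: zigzag_append)
next
  fix f X Y assume f: "f \<in> Hom Loc X Y"
  then obtain ss where ss: "f = zigzag_class C R X ss Y" "zigzag C R X ss Y"
    by (auto simp: Hom_Loc)
  then have "zigzag C R X [] X" "zigzag C R Y [] Y" using zigzag_Obj by auto
  then show "f \<star>\<^bsub>Loc\<^esub> Ide Loc X = f" "Ide Loc Y \<star>\<^bsub>Loc\<^esub> f = f"
    using ss Comp_Loc by (auto simp: Loc_simps)
next
  fix f W X g Y h Z
  assume "f \<in> Hom Loc W X" "g \<in> Hom Loc X Y" "h \<in> Hom Loc Y Z"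
  then show "(h \<star>\<^bsub>Loc\<^esub> g) \<star>\<^bsub>Loc\<^esub> f = h \<star>\<^bsub>Loc\<^esub> (g \<star>\<^bsub>Loc\<^esub> f)"
    by (auto simp: Hom_Loc Comp_Loc zigzag_append)
qed

end

text \<open>
  The last assumption contains the universal property of the counits, because they lie in \<open>R\<close>.
\<close>

locale coreflective_localisation = zigzag_category C R + D: category D
  for C :: "('o, 'm, 'z) category_scheme" and R :: "'m set"
    and D :: "('o, 'm, 'y) category_scheme" +
  fixes \<epsilon> :: "'o \<Rightarrow> 'm"
  assumes sub_Obj: "Obj D \<subseteq> Obj C"
    and sub_Hom: "\<lbrakk>X \<in> Obj D; Y \<in> Obj D\<rbrakk> \<Longrightarrow> Hom D X Y = Hom C X Y"
    and sub_Ide: "X \<in> Obj D \<Longrightarrow> Ide D X = Ide C X"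
    and sub_Comp: "\<lbrakk>f \<in> Hom D X Y; g \<in> Hom D Y Z\<rbrakk> \<Longrightarrow> g \<star>\<^bsub>D\<^esub> f = g \<star>\<^bsub>C\<^esub> f"
    and counit: "X \<in> Obj C \<Longrightarrow> \<epsilon> X \<in> R \<and> Cod C (\<epsilon> X) = X \<and> Dom C (\<epsilon> X) \<in> Obj D"
    and lift: "\<lbrakk>r \<in> R; X \<in> Obj D; g \<in> Hom C X (Cod C r)\<rbrakk>
      \<Longrightarrow> \<exists>!u. u \<in> Hom C X (Dom C r) \<and> r \<star>\<^bsub>C\<^esub> u = g"
begin

section \<open>The coreflector on zigzags\<close>

abbreviation E :: "'o \<Rightarrow> 'o" where "E X \<equiv> Dom C (\<epsilon> X)"

lemma E_Obj: "X \<in> Obj C \<Longrightarrow> E X \<in> Obj D" "X \<in> Obj C \<Longrightarrow> E X \<in> Obj C"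
  using counit sub_Obj by auto

lemma counit_Hom: "X \<in> Obj C \<Longrightarrow> \<epsilon> X \<in> Hom C (E X) X"
  using counit[of X] R_Arr by (auto simp: Hom_def)

lemma counit_lift:
  "\<lbrakk>K \<in> Obj D; g \<in> Hom C K X\<rbrakk> \<Longrightarrow> \<exists>!u. u \<in> Hom C K (E X) \<and> \<epsilon> X \<star>\<^bsub>C\<^esub> u = g"
  using lift[of "\<epsilon> X" K g] counit[of X] Hom_Obj by auto

text \<open>Naturality of the counit, read as a definition. For a backward step the equation is the
  one that an inverse of the image of \<open>r\<close> has to satisfy; that such an inverse exists
  is not presupposed.\<close>

primrec is_step_map :: "'m step \<Rightarrow> 'm \<Rightarrow> bool" where
  "is_step_map (Forward f) u \<longleftrightarrow> u \<in> Hom C (E (Dom C f)) (E (Cod C f)) \<and>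
     \<epsilon> (Cod C f) \<star>\<^bsub>C\<^esub> u = f \<star>\<^bsub>C\<^esub> \<epsilon> (Dom C f)"
| "is_step_map (Backward r) u \<longleftrightarrow> u \<in> Hom C (E (Cod C r)) (E (Dom C r)) \<and>
     r \<star>\<^bsub>C\<^esub> (\<epsilon> (Dom C r) \<star>\<^bsub>C\<^esub> u) = \<epsilon> (Cod C r)"

definition step_map :: "'m step \<Rightarrow> 'm" where
  "step_map s = (THE u. is_step_map s u)"

definition is_step :: "'m step \<Rightarrow> bool" where
  "is_step s \<longleftrightarrow> s \<in> Forward ` Arr C \<union> Backward ` R"

text \<open>A forward step takes one lift, along the counit at its target. A backward step takes
  two: the counit at \<open>Cod C r\<close> is lifted along \<open>r\<close>, and the result along
  the counit at \<open>Dom C r\<close>.\<close>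

lemma step_map_ex1: "is_step s \<Longrightarrow> \<exists>!u. is_step_map s u"
proof (cases s)
  case (Forward f)
  assume "is_step s"
  with Forward have f: "f \<in> Hom C (Dom C f) (Cod C f)" by (auto simp: is_step_def Hom_def)
  then have X: "Dom C f \<in> Obj C" using Hom_Obj by blast
  have "f \<star>\<^bsub>C\<^esub> \<epsilon> (Dom C f) \<in> Hom C (E (Dom C f)) (Cod C f)"
    using f counit_Hom[OF X] comp_in_Hom by blast
  then show ?thesis using counit_lift[OF E_Obj(1)[OF X]] Forward by simp
next
  case (Backward r)
  assume "is_step s"
  with Backward have r: "r \<in> R" "r \<in> Hom C (Dom C r) (Cod C r)"
    using R_Arr by (auto simp: is_step_def Hom_def)
  then have X: "Dom C r \<in> Obj C" "Cod C r \<in> Obj C" using Hom_Obj by blast+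
  note K = E_Obj(1)[OF X(2)]
  obtain v where v: "v \<in> Hom C (E (Cod C r)) (Dom C r)" "r \<star>\<^bsub>C\<^esub> v = \<epsilon> (Cod C r)"
    and v1: "\<And>v'. v' \<in> Hom C (E (Cod C r)) (Dom C r) \<Longrightarrow> r \<star>\<^bsub>C\<^esub> v' = \<epsilon> (Cod C r) \<Longrightarrow> v' = v"
    using lift[OF r(1) K counit_Hom[OF X(2)]] by blast
  obtain u where u: "u \<in> Hom C (E (Cod C r)) (E (Dom C r))" "\<epsilon> (Dom C r) \<star>\<^bsub>C\<^esub> u = v"
    and u1: "\<And>u'. u' \<in> Hom C (E (Cod C r)) (E (Dom C r)) \<Longrightarrow> \<epsilon> (Dom C r) \<star>\<^bsub>C\<^esub> u' = v \<Longrightarrow> u' = u"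
    using counit_lift[OF K v(1)] by blast
  show ?thesis
  proof
    show "is_step_map s u" using u v Backward by simp
    fix u' assume u': "is_step_map s u'"
    with Backward have "\<epsilon> (Dom C r) \<star>\<^bsub>C\<^esub> u' = v"
      using v1[OF comp_in_Hom[OF _ counit_Hom[OF X(1)]]] by simp
    with u' Backward u1 show "u' = u" by simp
  qed
qed

lemma step_mapI: "\<lbrakk>is_step s; is_step_map s u\<rbrakk> \<Longrightarrow> step_map s = u"
  unfolding step_map_def using step_map_ex1 by (blast intro: the1_equality)

lemma is_step_map_step_map: "is_step s \<Longrightarrow> is_step_map s (step_map s)"
  unfolding step_map_def by (rule theI'[OF step_map_ex1])

lemma step_map_Hom: "is_step s \<Longrightarrow> step_map s \<in> Hom C (E (step_dom C s)) (E (step_cod C s))"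
  using is_step_map_step_map[of s] by (cases s) auto

text \<open>The coreflector extended to zigzags. The start \<open>X\<close> is an argument because
  the empty list does not determine it.\<close>

primrec zigzag_map :: "'o \<Rightarrow> 'm step list \<Rightarrow> 'm" where
  "zigzag_map X [] = Ide C (E X)"
| "zigzag_map X (s # ss) = zigzag_map (step_cod C s) ss \<star>\<^bsub>C\<^esub> step_map s"

lemma zigzag_Cons: "zigzag C R X (s # ss) Y \<longleftrightarrow>
    is_step s \<and> step_dom C s = X \<and> zigzag C R (step_cod C s) ss Y"
  by (simp add: is_step_def)

lemma zigzag_map_Hom: "zigzag C R X ss Y \<Longrightarrow> zigzag_map X ss \<in> Hom C (E X) (E Y)"
proof (induction ss arbitrary: X)
  case Nil
  then show ?case using ide_in_Hom E_Obj by auto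
next
  case (Cons s ss)
  then show ?case unfolding zigzag_Cons
    using step_map_Hom comp_in_Hom by fastforce
qed

lemma zigzag_map_append:
  "\<lbrakk>zigzag C R X ss Y; zigzag C R Y ts Z\<rbrakk>
    \<Longrightarrow> zigzag_map X (ss @ ts) = zigzag_map Y ts \<star>\<^bsub>C\<^esub> zigzag_map X ss"
proof (induction ss arbitrary: X)
  case Nil
  then show ?case using comp_ide_right zigzag_map_Hom by fastforce
next
  case (Cons s ss)
  then have s: "is_step s" "step_dom C s = X" "zigzag C R (step_cod C s) ss Y"
    unfolding zigzag_Cons by auto
  show ?case
    using Cons.IH[OF s(3) Cons.prems(2)]
      comp_assoc[OF step_map_Hom[OF s(1)] zigzag_map_Hom[OF s(3)] zigzag_map_Hom[OF Cons.prems(2)]]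
    by simp
qed

lemma step_map_Forward:
  assumes "f \<in> Hom C X Y" "u \<in> Hom C (E X) (E Y)" "\<epsilon> Y \<star>\<^bsub>C\<^esub> u = f \<star>\<^bsub>C\<^esub> \<epsilon> X"
  shows "step_map (Forward f) = u"
  using assms by (intro step_mapI) (auto simp: is_step_def Hom_def)

lemma step_map_ForwardD:
  assumes "f \<in> Hom C X Y"
  shows "step_map (Forward f) \<in> Hom C (E X) (E Y)" "\<epsilon> Y \<star>\<^bsub>C\<^esub> step_map (Forward f) = f \<star>\<^bsub>C\<^esub> \<epsilon> X"
  using assms is_step_map_step_map[of "Forward f"] by (auto simp: is_step_def Hom_def)

lemma step_map_Ide: "X \<in> Obj C \<Longrightarrow> step_map (Forward (Ide C X)) = Ide C (E X)"
  using step_map_Forward[OF ide_in_Hom ide_in_Hom[OF E_Obj(2)]] counit_Hom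
    comp_ide_left comp_ide_right by metis

lemma step_map_Comp:
  assumes f: "f \<in> Hom C X Y" and g: "g \<in> Hom C Y Z"
  shows "step_map (Forward (g \<star>\<^bsub>C\<^esub> f)) = step_map (Forward g) \<star>\<^bsub>C\<^esub> step_map (Forward f)"
proof (rule step_map_Forward[OF comp_in_Hom[OF f g]])
  note F = step_map_ForwardD[OF f] and G = step_map_ForwardD[OF g]
  have X: "X \<in> Obj C" "Y \<in> Obj C" "Z \<in> Obj C" using Hom_Obj f g by auto
  show "step_map (Forward g) \<star>\<^bsub>C\<^esub> step_map (Forward f) \<in> Hom C (E X) (E Z)"
    using F G comp_in_Hom by blast
  have "\<epsilon> Z \<star>\<^bsub>C\<^esub> (step_map (Forward g) \<star>\<^bsub>C\<^esub> step_map (Forward f))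
      = (g \<star>\<^bsub>C\<^esub> \<epsilon> Y) \<star>\<^bsub>C\<^esub> step_map (Forward f)"
    using comp_assoc[OF F(1) G(1) counit_Hom[OF X(3)]] G(2) by simp
  also have "\<dots> = g \<star>\<^bsub>C\<^esub> (f \<star>\<^bsub>C\<^esub> \<epsilon> X)"
    using comp_assoc[OF F(1) counit_Hom[OF X(2)] g] F(2) by simp
  also have "\<dots> = (g \<star>\<^bsub>C\<^esub> f) \<star>\<^bsub>C\<^esub> \<epsilon> X"
    using comp_assoc[OF counit_Hom[OF X(1)] f g] by simp
  finally show "\<epsilon> Z \<star>\<^bsub>C\<^esub> (step_map (Forward g) \<star>\<^bsub>C\<^esub> step_map (Forward f)) = (g \<star>\<^bsub>C\<^esub> f) \<star>\<^bsub>C\<^esub> \<epsilon> X" .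
qed

lemma step_map_inverse:
  assumes r: "r \<in> R"
  defines "u \<equiv> step_map (Forward r)" and "v \<equiv> step_map (Backward r)"
  shows "v \<star>\<^bsub>C\<^esub> u = Ide C (E (Dom C r))" "u \<star>\<^bsub>C\<^esub> v = Ide C (E (Cod C r))"
proof -
  define X Y where "X = Dom C r" and "Y = Cod C r"
  have rH: "r \<in> Hom C X Y" using r R_Arr by (auto simp: Hom_def X_def Y_def)
  have X: "X \<in> Obj C" "Y \<in> Obj C" using Hom_Obj rH by auto
  note e = counit_Hom[OF X(1)] counit_Hom[OF X(2)]
  have u: "u \<in> Hom C (E X) (E Y)" "\<epsilon> Y \<star>\<^bsub>C\<^esub> u = r \<star>\<^bsub>C\<^esub> \<epsilon> X"
    using step_map_ForwardD[OF rH] by (auto simp: u_def)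
  have v: "v \<in> Hom C (E Y) (E X)" "r \<star>\<^bsub>C\<^esub> (\<epsilon> X \<star>\<^bsub>C\<^esub> v) = \<epsilon> Y"
    using is_step_map_step_map[of "Backward r"] r by (auto simp: v_def X_def Y_def is_step_def)
  have ev: "\<epsilon> X \<star>\<^bsub>C\<^esub> v \<in> Hom C (E Y) X" using comp_in_Hom[OF v(1) e(1)] .
  have vu: "v \<star>\<^bsub>C\<^esub> u \<in> Hom C (E X) (E X)" and uv: "u \<star>\<^bsub>C\<^esub> v \<in> Hom C (E Y) (E Y)"
    using u v comp_in_Hom by auto
  have "\<epsilon> Y \<star>\<^bsub>C\<^esub> (u \<star>\<^bsub>C\<^esub> v) = (r \<star>\<^bsub>C\<^esub> \<epsilon> X) \<star>\<^bsub>C\<^esub> v"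
    using comp_assoc[OF v(1) u(1) e(2)] u(2) by simp
  also have "\<dots> = \<epsilon> Y" using comp_assoc[OF v(1) e(1) rH] v(2) by simp
  finally have "\<epsilon> Y \<star>\<^bsub>C\<^esub> (u \<star>\<^bsub>C\<^esub> v) = \<epsilon> Y" .
  moreover have "\<epsilon> Y \<star>\<^bsub>C\<^esub> Ide C (E Y) = \<epsilon> Y" using comp_ide_right[OF e(2)] .
  ultimately have "u \<star>\<^bsub>C\<^esub> v = Ide C (E Y)"
    using counit_lift[OF E_Obj(1)[OF X(2)] e(2)] uv ide_in_Hom[OF E_Obj(2)[OF X(2)]] by blast
  then show "u \<star>\<^bsub>C\<^esub> v = Ide C (E (Cod C r))" by (simp add: Y_def)
  have "r \<star>\<^bsub>C\<^esub> (\<epsilon> X \<star>\<^bsub>C\<^esub> (v \<star>\<^bsub>C\<^esub> u)) = r \<star>\<^bsub>C\<^esub> ((\<epsilon> X \<star>\<^bsub>C\<^esub> v) \<star>\<^bsub>C\<^esub> u)"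
    using comp_assoc[OF u(1) v(1) e(1)] by simp
  also have "\<dots> = r \<star>\<^bsub>C\<^esub> \<epsilon> X"
    using comp_assoc[OF u(1) ev rH] u(2) v(2) by simp
  finally have "r \<star>\<^bsub>C\<^esub> (\<epsilon> X \<star>\<^bsub>C\<^esub> (v \<star>\<^bsub>C\<^esub> u)) = r \<star>\<^bsub>C\<^esub> \<epsilon> X" .
  then have "\<epsilon> X \<star>\<^bsub>C\<^esub> (v \<star>\<^bsub>C\<^esub> u) = \<epsilon> X"
    using lift[OF r E_Obj(1)[OF X(1)], of "r \<star>\<^bsub>C\<^esub> \<epsilon> X"] e(1) comp_in_Hom[OF vu e(1)]
      comp_in_Hom[OF e(1) rH] by (auto simp: X_def Y_def)
  moreover have "\<epsilon> X \<star>\<^bsub>C\<^esub> Ide C (E X) = \<epsilon> X" using comp_ide_right[OF e(1)] .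
  ultimately have "v \<star>\<^bsub>C\<^esub> u = Ide C (E X)"
    using counit_lift[OF E_Obj(1)[OF X(1)] e(1)] vu ide_in_Hom[OF E_Obj(2)[OF X(1)]] by blast
  then show "v \<star>\<^bsub>C\<^esub> u = Ide C (E (Dom C r))" by (simp add: X_def)
qed

lemma zigzag_map_single: "zigzag C R X [s] Y \<Longrightarrow> zigzag_map X [s] = step_map s"
  unfolding zigzag_Cons using step_map_Hom comp_ide_left by fastforce

text \<open>The coreflector sends \<open>R\<close> to isomorphisms by
  \<open>step_map_inverse\<close>, so its extension to zigzags respects the generating relations and
  descends to the localisation.\<close>

lemma zigzag_map_cong: "zigzag_eq C R X Y ss ts \<Longrightarrow> zigzag_map X ss = zigzag_map X ts"
proof (induction rule: zigzag_eq.induct)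
  case (zz_append X Y ss ss' Z ts ts')
  then show ?case using zigzag_eq_imp_zigzag zigzag_map_append by metis
next
  case (zz_ide X)
  then show ?case
    using zigzag_map_single[OF zigzag_Forward[OF ide_in_Hom]] step_map_Ide by simp
next
  case (zz_comp f X Y g Z)
  then show ?case
    using zigzag_map_single[OF zigzag_Forward[OF zz_comp(1)]]
      zigzag_map_single[OF zigzag_Forward[OF zz_comp(2)]]
      zigzag_map_single[OF zigzag_Forward[OF comp_in_Hom[OF zz_comp]]]
      zigzag_map_append[OF zigzag_Forward[OF zz_comp(1)] zigzag_Forward[OF zz_comp(2)]]
      step_map_Comp[OF zz_comp] by simp
next
  case (zz_inv1 r)
  then have r: "r \<in> Hom C (Dom C r) (Cod C r)" using R_Arr by (auto simp: Hom_def)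
  show ?case
    using zigzag_map_single[OF zigzag_Forward[OF r]]
      zigzag_map_single[OF zigzag_Backward[OF zz_inv1 refl refl]]
      zigzag_map_append[OF zigzag_Forward[OF r] zigzag_Backward[OF zz_inv1 refl refl]]
      step_map_inverse(1)[OF zz_inv1] by simp
next
  case (zz_inv2 r)
  then have r: "r \<in> Hom C (Dom C r) (Cod C r)" using R_Arr by (auto simp: Hom_def)
  show ?case
    using zigzag_map_single[OF zigzag_Forward[OF r]]
      zigzag_map_single[OF zigzag_Backward[OF zz_inv2 refl refl]]
      zigzag_map_append[OF zigzag_Backward[OF zz_inv2 refl refl] zigzag_Forward[OF r]]
      step_map_inverse(2)[OF zz_inv2] by simp
qed auto

section \<open>The two functors and the natural isomorphisms between their composites and the
  identities\<close>

definition Loc_map :: "'o \<times> 'm step list set \<times> 'o \<Rightarrow> 'm" where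
  "Loc_map = (\<lambda>(X, P, Y). zigzag_map X (SOME ss. ss \<in> P))"

lemma Loc_map_zigzag_class:
  assumes "zigzag C R X ss Y"
  shows "Loc_map (zigzag_class C R X ss Y) = zigzag_map X ss"
proof -
  \<comment> \<open>Reflexivity makes the class nonempty, so the representative that
    \<open>Loc_map\<close> chooses is equal to \<open>ss\<close> as a zigzag.\<close>
  have "zigzag_eq C R X Y ss (SOME ts. zigzag_eq C R X Y ss ts)"
    by (rule someI) (rule zz_refl[OF assms])
  then show ?thesis using zigzag_map_cong by (simp add: Loc_map_def zigzag_class_def)
qed

lemma functor_Loc_map: "is_functor Loc D E Loc_map"
  unfolding is_functor_def
proof (intro conjI ballI impI)
  fix X assume "X \<in> Obj Loc"
  then have X: "X \<in> Obj C" "zigzag C R X [] X" by (auto simp: Loc_simps)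
  then show "E X \<in> Obj D" using E_Obj by auto
  show "Loc_map (Ide Loc X) = Ide D (E X)"
    using Loc_map_zigzag_class[OF X(2)] sub_Ide[OF E_Obj(1)[OF X(1)]] by (simp add: Loc_simps)
next
  fix f assume "f \<in> Arr Loc"
  then obtain X ss Y where f: "f = zigzag_class C R X ss Y" "zigzag C R X ss Y"
    by (auto simp: Loc_simps)
  then show "Loc_map f \<in> Hom D (E (Dom Loc f)) (E (Cod Loc f))"
    using zigzag_map_Hom[OF f(2)] sub_Hom E_Obj zigzag_Obj
    by (auto simp: Loc_simps Loc_map_zigzag_class)
next
  fix f g assume fg: "f \<in> Arr Loc" "g \<in> Arr Loc" "Cod Loc f = Dom Loc g"
  from fg(1) obtain X ss Y where f: "f = zigzag_class C R X ss Y" "zigzag C R X ss Y"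
    by (auto simp: Loc_simps)
  with fg obtain ts Z where g: "g = zigzag_class C R Y ts Z" "zigzag C R Y ts Z"
    by (auto simp: Loc_simps)
  have "zigzag_map X ss \<in> Hom D (E X) (E Y)" "zigzag_map Y ts \<in> Hom D (E Y) (E Z)"
    using zigzag_map_Hom f g sub_Hom E_Obj zigzag_Obj by metis+
  then show "Loc_map (g \<star>\<^bsub>Loc\<^esub> f) = Loc_map g \<star>\<^bsub>D\<^esub> Loc_map f"
    using f g by (simp add: Comp_Loc Loc_map_zigzag_class zigzag_append zigzag_map_append sub_Comp)
qed

definition incl :: "'m \<Rightarrow> 'o \<times> 'm step list set \<times> 'o" where
  "incl f = zigzag_class C R (Dom C f) [Forward f] (Cod C f)"

lemma Hom_D_C: "f \<in> Hom D X Y \<Longrightarrow> f \<in> Hom C X Y"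
  using sub_Hom D.Hom_Obj by blast

lemma incl_Hom: "f \<in> Hom C X Y \<Longrightarrow> incl f = zigzag_class C R X [Forward f] Y"
  by (auto simp: incl_def Hom_def)

lemma functor_incl: "is_functor D Loc id incl"
  unfolding is_functor_def
proof (intro conjI ballI impI)
  fix X assume X: "X \<in> Obj D"
  then show "id X \<in> Obj Loc" using sub_Obj by (auto simp: Loc_simps)
  have XC: "X \<in> Obj C" using X sub_Obj by blast
  show "incl (Ide D X) = Ide Loc (id X)"
    using zz_ide[OF XC, of R] zigzag_class_eq_iff[OF zigzag_Forward[OF ide_in_Hom[OF XC]]]
    by (simp add: sub_Ide[OF X] incl_Hom[OF ide_in_Hom[OF XC]] Loc_simps)
next
  fix f assume "f \<in> Arr D"
  then have "f \<in> Hom C (Dom D f) (Cod D f)" by (intro Hom_D_C) (simp add: Hom_def)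
  then show "incl f \<in> Hom Loc (id (Dom D f)) (id (Cod D f))"
    unfolding Hom_Loc incl_Hom[OF \<open>f \<in> Hom C (Dom D f) (Cod D f)\<close>] id_apply
    by (blast intro: zigzag_Forward \<open>f \<in> Hom C (Dom D f) (Cod D f)\<close>)
next
  fix f g assume "f \<in> Arr D" "g \<in> Arr D" "Cod D f = Dom D g"
  then have fD: "f \<in> Hom D (Dom D f) (Cod D f)" "g \<in> Hom D (Cod D f) (Cod D g)"
    by (simp_all add: Hom_def)
  then have f: "f \<in> Hom C (Dom D f) (Cod D f)" and g: "g \<in> Hom C (Cod D f) (Cod D g)"
    using Hom_D_C by auto
  note gf = comp_in_Hom[OF f g]
  show "incl (g \<star>\<^bsub>D\<^esub> f) = incl g \<star>\<^bsub>Loc\<^esub> incl f"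
    using zigzag_class_eq_iff[OF zigzag_Forward[OF gf]] zz_sym[OF zz_comp[OF f g]]
    unfolding sub_Comp[OF fD] incl_Hom[OF f] incl_Hom[OF g] incl_Hom[OF gf]
      Comp_Loc[OF zigzag_Forward[OF f] zigzag_Forward[OF g]] by simp
qed

lemmas zigzag_eq_trans [trans] = zz_trans

text \<open>Naturality of the counit, extended from morphisms to zigzags by induction on the length.
  It yields a normal form: every zigzag equals an inverse counit, followed by one morphism of
  \<open>D\<close> and a counit.\<close>

lemma zigzag_eq_counit_natural:
  "zigzag C R X ss Y \<Longrightarrow>
    zigzag_eq C R (E X) Y (Forward (\<epsilon> X) # ss) [Forward (zigzag_map X ss), Forward (\<epsilon> Y)]"
proof (induction ss arbitrary: X)
  case Nil
  then have X: "X \<in> Obj C" "Y = X" by auto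
  note e = counit_Hom[OF X(1)] and i = ide_in_Hom[OF E_Obj(2)[OF X(1)]]
  show ?case
    using zz_sym[OF zz_comp[OF i e, of R]] X(2) comp_ide_right[OF e] by simp
next
  case (Cons s ss)
  then have s: "is_step s" "step_dom C s = X" and ss: "zigzag C R (step_cod C s) ss Y"
    unfolding zigzag_Cons by auto
  let ?Z = "step_cod C s" and ?u = "step_map s"
  have Z: "?Z \<in> Obj C" "Y \<in> Obj C" using zigzag_Obj[OF ss] by auto
  have X: "X \<in> Obj C" using Cons.prems zigzag_Obj by blast
  note u = step_map_Hom[OF s(1), unfolded s(2)]
  note e = counit_Hom[OF X] counit_Hom[OF Z(1)] counit_Hom[OF Z(2)]
  note m = zigzag_map_Hom[OF ss]
  have step: "zigzag_eq C R (E X) ?Z [Forward (\<epsilon> X), s] [Forward ?u, Forward (\<epsilon> ?Z)]"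
  proof (cases s)
    case (Forward f)
    then have f: "f \<in> Hom C X ?Z" using s by (auto simp: is_step_def Hom_def)
    show ?thesis
      using zz_trans[OF zz_comp[OF e(1) f, of R]] zz_sym[OF zz_comp[OF u e(2), of R]]
        step_map_ForwardD(2)[OF f] Forward by simp
  next
    case (Backward r)
    then have r: "r \<in> R" "Cod C r = X" "Dom C r = ?Z" using s by (auto simp: is_step_def)
    then have rH: "r \<in> Hom C ?Z X" using R_Arr by (auto simp: Hom_def)
    have "is_step_map (Backward r) ?u" using is_step_map_step_map[OF s(1)] Backward by metis
    then have eq: "r \<star>\<^bsub>C\<^esub> (\<epsilon> ?Z \<star>\<^bsub>C\<^esub> ?u) = \<epsilon> X" unfolding is_step_map.simps r by blast
    note eu = comp_in_Hom[OF u e(2)]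
    note zB = zz_refl[OF zigzag_Backward[OF r]]
    \<comment> \<open>Writing the counit at \<open>X\<close> as a composite ending in
      \<open>r\<close> puts \<open>r\<close> next to its formal inverse, and the pair
      cancels.\<close>
    have "zigzag_eq C R (E X) ?Z ([Forward (\<epsilon> X)] @ [Backward r])
        ([Forward (\<epsilon> ?Z \<star>\<^bsub>C\<^esub> ?u), Forward r] @ [Backward r])"
      using zz_append[OF zz_sym[OF zz_comp[OF eu rH]] zB] unfolding eq .
    also have "\<dots> = [Forward (\<epsilon> ?Z \<star>\<^bsub>C\<^esub> ?u)] @ [Forward r, Backward r]" by simp
    also have "zigzag_eq C R (E X) ?Z \<dots> ([Forward (\<epsilon> ?Z \<star>\<^bsub>C\<^esub> ?u)] @ [])"
      using zz_append[OF zz_refl[OF zigzag_Forward[OF eu]]] zz_inv1[OF r(1), of C] r(3) by metis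
    also have "\<dots> = [Forward (\<epsilon> ?Z \<star>\<^bsub>C\<^esub> ?u)]" by simp
    also have "zigzag_eq C R (E X) ?Z \<dots> [Forward ?u, Forward (\<epsilon> ?Z)]"
      by (rule zz_sym[OF zz_comp[OF u e(2)]])
    finally show ?thesis by (simp only: Backward append.simps)
  qed
  have "zigzag_eq C R (E X) Y ([Forward (\<epsilon> X), s] @ ss) ([Forward ?u, Forward (\<epsilon> ?Z)] @ ss)"
    by (rule zz_append[OF step zz_refl[OF ss]])
  also have "\<dots> = [Forward ?u] @ (Forward (\<epsilon> ?Z) # ss)" by simp
  also have "zigzag_eq C R (E X) Y \<dots> ([Forward ?u] @ [Forward (zigzag_map ?Z ss), Forward (\<epsilon> Y)])"
    by (rule zz_append[OF zz_refl[OF zigzag_Forward[OF u]] Cons.IH[OF ss]])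
  also have "\<dots> = [Forward ?u, Forward (zigzag_map ?Z ss)] @ [Forward (\<epsilon> Y)]" by simp
  also have "zigzag_eq C R (E X) Y \<dots> ([Forward (zigzag_map ?Z ss \<star>\<^bsub>C\<^esub> ?u)] @ [Forward (\<epsilon> Y)])"
    by (rule zz_append[OF zz_comp[OF u m] zz_refl[OF zigzag_Forward[OF e(3)]]])
  finally show ?case by simp
qed

text \<open>The unit at \<open>X\<close> is the formal inverse of the counit, invertible by the
  defining relations. Its naturality is \<open>zigzag_eq_counit_natural\<close> with the counits
  moved to the other side.\<close>

lemma natural_isomorphism_Loc:
  "natural_isomorphism Loc Loc id id (id \<circ> E) (incl \<circ> Loc_map)
    (\<lambda>X. zigzag_class C R X [Backward (\<epsilon> X)] (E X))"
  unfolding natural_isomorphism_def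
proof (intro conjI ballI)
  fix X assume "X \<in> Obj Loc"
  then have X: "X \<in> Obj C" by (simp add: Loc_simps)
  have b: "zigzag C R X [Backward (\<epsilon> X)] (E X)" using zigzag_Backward counit[OF X] by blast
  have f: "zigzag C R (E X) [Forward (\<epsilon> X)] X" using zigzag_Forward[OF counit_Hom[OF X]] .
  show "zigzag_class C R X [Backward (\<epsilon> X)] (E X) \<in> Hom Loc (id X) ((id \<circ> E) X)"
    using b by (auto simp: Hom_Loc)
  have inv: "zigzag_eq C R (E X) (E X) [Forward (\<epsilon> X), Backward (\<epsilon> X)] []"
    "zigzag_eq C R X X [Backward (\<epsilon> X), Forward (\<epsilon> X)] []"
    using zz_inv1[of "\<epsilon> X" R C] zz_inv2[of "\<epsilon> X" R C] counit[OF X] by auto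
  show "isomorphism Loc (zigzag_class C R X [Backward (\<epsilon> X)] (E X))"
  proof (rule category.isomorphismI[OF category_Loc])
    show "zigzag_class C R X [Backward (\<epsilon> X)] (E X) \<in> Hom Loc X (E X)"
      "zigzag_class C R (E X) [Forward (\<epsilon> X)] X \<in> Hom Loc (E X) X"
      unfolding Hom_Loc using b f by blast+
    show "zigzag_class C R (E X) [Forward (\<epsilon> X)] X \<star>\<^bsub>Loc\<^esub> zigzag_class C R X [Backward (\<epsilon> X)] (E X)
        = Ide Loc X"
      unfolding Comp_Loc[OF b f] Loc_simps zigzag_class_eq_iff[OF zigzag_append[OF b f]]
      using inv(2) by simp
    show "zigzag_class C R X [Backward (\<epsilon> X)] (E X) \<star>\<^bsub>Loc\<^esub> zigzag_class C R (E X) [Forward (\<epsilon> X)] X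
        = Ide Loc (E X)"
      unfolding Comp_Loc[OF f b] Loc_simps zigzag_class_eq_iff[OF zigzag_append[OF f b]]
      using inv(1) by simp
  qed
next
  fix f assume "f \<in> Arr Loc"
  then obtain X ss Y where f: "f = zigzag_class C R X ss Y" and ss: "zigzag C R X ss Y"
    by (auto simp: Loc_simps)
  have X: "X \<in> Obj C" "Y \<in> Obj C" using zigzag_Obj[OF ss] by auto
  have bX: "zigzag C R X [Backward (\<epsilon> X)] (E X)" and bY: "zigzag C R Y [Backward (\<epsilon> Y)] (E Y)"
    using zigzag_Backward counit[OF X(1)] counit[OF X(2)] by auto
  let ?m = "zigzag_map X ss"
  note m = zigzag_map_Hom[OF ss]
  note rX = zz_refl[OF bX] and rY = zz_refl[OF bY]
  have inv: "zigzag_eq C R X X ([Backward (\<epsilon> X)] @ [Forward (\<epsilon> X)]) []"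
    "zigzag_eq C R (E Y) (E Y) [Forward (\<epsilon> Y), Backward (\<epsilon> Y)] []"
    using zz_inv2[of "\<epsilon> X" R C] zz_inv1[of "\<epsilon> Y" R C] counit[OF X(1)] counit[OF X(2)] by auto
  \<comment> \<open>A cancelling pair is inserted in front to bring the zigzag into the shape of
    \<open>zigzag_eq_counit_natural\<close>.\<close>
  have "zigzag_eq C R X (E Y) ([] @ (ss @ [Backward (\<epsilon> Y)])) (([Backward (\<epsilon> X)] @ [Forward (\<epsilon> X)]) @ (ss @ [Backward (\<epsilon> Y)]))"
    by (rule zz_append[OF zz_sym[OF inv(1)] zz_refl[OF zigzag_append[OF ss bY]]])
  also have "\<dots> = [Backward (\<epsilon> X)] @ (Forward (\<epsilon> X) # ss) @ [Backward (\<epsilon> Y)]" by simp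
  also have "zigzag_eq C R X (E Y) \<dots>
      ([Backward (\<epsilon> X)] @ [Forward ?m, Forward (\<epsilon> Y)] @ [Backward (\<epsilon> Y)])"
    by (rule zz_append[OF rX zz_append[OF zigzag_eq_counit_natural[OF ss] rY]])
  also have "\<dots> = [Backward (\<epsilon> X)] @ [Forward ?m] @ [Forward (\<epsilon> Y), Backward (\<epsilon> Y)]" by simp
  also have "zigzag_eq C R X (E Y) \<dots> ([Backward (\<epsilon> X)] @ [Forward ?m] @ [])"
    by (rule zz_append[OF rX zz_append[OF zz_refl[OF zigzag_Forward[OF m]] inv(2)]])
  finally have "zigzag_eq C R X (E Y) (ss @ [Backward (\<epsilon> Y)]) ([Backward (\<epsilon> X)] @ [Forward ?m])"
    by simp
  then show "zigzag_class C R (Cod Loc f) [Backward (\<epsilon> (Cod Loc f))] (E (Cod Loc f)) \<star>\<^bsub>Loc\<^esub> id f =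
      (incl \<circ> Loc_map) f \<star>\<^bsub>Loc\<^esub> zigzag_class C R (Dom Loc f) [Backward (\<epsilon> (Dom Loc f))] (E (Dom Loc f))"
    using Comp_Loc[OF ss bY] Comp_Loc[OF bX zigzag_Forward[OF m]] zigzag_class_eq_iff[OF zigzag_append[OF ss bY]]
    by (simp add: f Loc_simps Loc_map_zigzag_class[OF ss] incl_Hom[OF m])
qed

text \<open>For \<open>X\<close> in \<open>D\<close> the identity of \<open>X\<close> itself lifts
  along the counit. This gives a section, and uniqueness of lifts makes it a two-sided
  inverse.\<close>

lemma natural_isomorphism_counit:
  "natural_isomorphism D D (E \<circ> id) (Loc_map \<circ> incl) id id \<epsilon>"
  unfolding natural_isomorphism_def
proof (intro conjI ballI)
  fix X assume X: "X \<in> Obj D"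
  then have XC: "X \<in> Obj C" using sub_Obj by blast
  note e = counit_Hom[OF XC] and EX = E_Obj[OF XC]
  show eD: "\<epsilon> X \<in> Hom D ((E \<circ> id) X) (id X)" using e sub_Hom[OF EX(1) X] by simp
  obtain s where s: "s \<in> Hom C X (E X)" "\<epsilon> X \<star>\<^bsub>C\<^esub> s = Ide C X"
    using counit_lift[OF X ide_in_Hom[OF XC]] by blast
  have se: "s \<star>\<^bsub>C\<^esub> \<epsilon> X \<in> Hom C (E X) (E X)" using comp_in_Hom[OF e s(1)] .
  have "\<epsilon> X \<star>\<^bsub>C\<^esub> (s \<star>\<^bsub>C\<^esub> \<epsilon> X) = \<epsilon> X"
    using comp_assoc[OF e s(1) e] s(2) comp_ide_left[OF e] by simp
  then have "s \<star>\<^bsub>C\<^esub> \<epsilon> X = Ide C (E X)"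
    using counit_lift[OF EX(1) e] se ide_in_Hom[OF EX(2)] comp_ide_right[OF e] by blast
  then show "isomorphism D (\<epsilon> X)"
    using D.isomorphismI[of "\<epsilon> X" "E X" X s] eD s sub_Hom[OF X EX(1)] sub_Comp[of "\<epsilon> X" "E X" X s]
      sub_Comp[of s X "E X" "\<epsilon> X" X] sub_Ide[OF X] sub_Ide[OF EX(1)] by auto
next
  fix f assume "f \<in> Arr D"
  then have fD: "f \<in> Hom D (Dom D f) (Cod D f)" by (simp add: Hom_def)
  let ?X = "Dom D f" and ?Y = "Cod D f"
  note f = Hom_D_C[OF fD]
  have X: "?X \<in> Obj D" "?Y \<in> Obj D" using D.Hom_Obj[OF fD] by auto
  have XC: "?X \<in> Obj C" "?Y \<in> Obj C" using X sub_Obj by auto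
  note F = step_map_ForwardD[OF f]
  have m: "Loc_map (incl f) = step_map (Forward f)"
    using zigzag_map_single[OF zigzag_Forward[OF f]]
    by (simp add: incl_Hom[OF f] Loc_map_zigzag_class[OF zigzag_Forward[OF f]] del: zigzag_map.simps)
  have "step_map (Forward f) \<in> Hom D (E ?X) (E ?Y)" "\<epsilon> ?Y \<in> Hom D (E ?Y) ?Y" "\<epsilon> ?X \<in> Hom D (E ?X) ?X"
    using F(1) counit_Hom XC X E_Obj(1) sub_Hom by simp_all
  then have "\<epsilon> ?Y \<star>\<^bsub>D\<^esub> step_map (Forward f) = f \<star>\<^bsub>D\<^esub> \<epsilon> ?X"
    using F(2) fD by (simp add: sub_Comp)
  then show "\<epsilon> (Cod D f) \<star>\<^bsub>D\<^esub> (Loc_map \<circ> incl) f = id f \<star>\<^bsub>D\<^esub> \<epsilon> (Dom D f)"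
    using m by simp
qed

theorem equivalent_localisation: "equivalent_categories Loc D"
  unfolding equivalent_categories_def
  using category_Loc D.category_axioms functor_Loc_map functor_incl natural_isomorphism_Loc
    natural_isomorphism_counit by blast

end

section \<open>Quotients by ideals of morphisms\<close>

context preadditive_category
begin

definition neg :: "'m \<Rightarrow> 'm" where
  "neg f = inv\<^bsub>hom_group C (Dom C f) (Cod C f)\<^esub> f"

lemma hom_group_simps:
  "carrier (hom_group C X Y) = Hom C X Y" "mult (hom_group C X Y) = Add C"
  "one (hom_group C X Y) = Zero C X Y"
  by (simp_all add: hom_group_def)

lemma hom_group: "\<lbrakk>X \<in> Obj C; Y \<in> Obj C\<rbrakk> \<Longrightarrow> group (hom_group C X Y)"
  using hom_comm_group comm_group.axioms(2) by blast

lemma add_in_Hom: "\<lbrakk>f \<in> Hom C X Y; g \<in> Hom C X Y\<rbrakk> \<Longrightarrow> f \<boxplus> g \<in> Hom C X Y"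
  using monoid.m_closed[OF group.is_monoid[OF hom_group], of X Y f g] Hom_Obj[of f X Y]
  by (simp add: hom_group_simps)

lemma zero_in_Hom: "\<lbrakk>X \<in> Obj C; Y \<in> Obj C\<rbrakk> \<Longrightarrow> Zero C X Y \<in> Hom C X Y"
  using monoid.one_closed[OF group.is_monoid[OF hom_group], of X Y] by (simp add: hom_group_simps)

lemma add_assoc: "\<lbrakk>f \<in> Hom C X Y; g \<in> Hom C X Y; h \<in> Hom C X Y\<rbrakk> \<Longrightarrow> (f \<boxplus> g) \<boxplus> h = f \<boxplus> (g \<boxplus> h)"
  using monoid.m_assoc[OF group.is_monoid[OF hom_group], of X Y f g h] Hom_Obj[of f X Y]
  by (simp add: hom_group_simps)

lemma add_commute: "\<lbrakk>f \<in> Hom C X Y; g \<in> Hom C X Y\<rbrakk> \<Longrightarrow> f \<boxplus> g = g \<boxplus> f"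
  using comm_monoid.m_comm[OF comm_group.axioms(1)[OF hom_comm_group], of X Y f g] Hom_Obj[of f X Y]
  by (simp add: hom_group_simps)

lemma add_zero_left: "f \<in> Hom C X Y \<Longrightarrow> Zero C X Y \<boxplus> f = f"
  using monoid.l_one[OF group.is_monoid[OF hom_group], of X Y f] Hom_Obj[of f X Y]
  by (simp add: hom_group_simps)

lemma add_zero_right: "f \<in> Hom C X Y \<Longrightarrow> f \<boxplus> Zero C X Y = f"
  using monoid.r_one[OF group.is_monoid[OF hom_group], of X Y f] Hom_Obj[of f X Y]
  by (simp add: hom_group_simps)

lemma neg_in_Hom: "f \<in> Hom C X Y \<Longrightarrow> neg f \<in> Hom C X Y"
  using group.inv_closed[OF hom_group, of X Y f] Hom_Obj[of f X Y] Hom_D[of f C X Y]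
  by (simp add: hom_group_simps neg_def)

lemma add_neg_left: "f \<in> Hom C X Y \<Longrightarrow> neg f \<boxplus> f = Zero C X Y"
  using group.l_inv[OF hom_group, of X Y f] Hom_Obj[of f X Y] Hom_D[of f C X Y]
  by (simp add: hom_group_simps neg_def)

lemma add_neg_right: "f \<in> Hom C X Y \<Longrightarrow> f \<boxplus> neg f = Zero C X Y"
  using add_neg_left add_commute neg_in_Hom by metis

lemma add_right_imp_zero:
  assumes "f \<in> Hom C X Y" "g \<in> Hom C X Y" "f \<boxplus> g = g"
  shows "f = Zero C X Y"
  using add_assoc[OF assms(1,2) neg_in_Hom[OF assms(2)]] assms(3) add_neg_right[OF assms(2)]
    add_zero_right[OF assms(1)] by simp

lemma neg_unique:
  assumes "f \<in> Hom C X Y" "g \<in> Hom C X Y" "f \<boxplus> g = Zero C X Y"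
  shows "f = neg g"
  using add_assoc[OF assms(1,2) neg_in_Hom[OF assms(2)]] assms(3) add_neg_right[OF assms(2)]
    add_zero_right[OF assms(1)] add_zero_left[OF neg_in_Hom[OF assms(2)]] by simp

lemma comp_zero_right:
  assumes "X \<in> Obj C" "g \<in> Hom C Y Z"
  shows "g \<star> Zero C X Y = Zero C X Z"
proof (rule add_right_imp_zero)
  have z: "Zero C X Y \<in> Hom C X Y" using zero_in_Hom assms Hom_Obj by blast
  show "g \<star> Zero C X Y \<in> Hom C X Z" using comp_in_Hom z assms by blast
  then show "g \<star> Zero C X Y \<in> Hom C X Z" .
  show "(g \<star> Zero C X Y) \<boxplus> (g \<star> Zero C X Y) = g \<star> Zero C X Y"
    using comp_add_right[OF z z assms(2)] add_zero_left[OF z] by simp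
qed

lemma comp_zero_left:
  assumes "Z \<in> Obj C" "g \<in> Hom C X Y"
  shows "Zero C Y Z \<star> g = Zero C X Z"
proof (rule add_right_imp_zero)
  have z: "Zero C Y Z \<in> Hom C Y Z" using zero_in_Hom assms Hom_Obj by blast
  show "Zero C Y Z \<star> g \<in> Hom C X Z" using comp_in_Hom z assms by blast
  then show "Zero C Y Z \<star> g \<in> Hom C X Z" .
  show "(Zero C Y Z \<star> g) \<boxplus> (Zero C Y Z \<star> g) = Zero C Y Z \<star> g"
    using comp_add_left[OF assms(2) z z] add_zero_left[OF z] by simp
qed

lemma comp_neg_right:
  assumes "f \<in> Hom C X Y" "g \<in> Hom C Y Z"
  shows "g \<star> neg f = neg (g \<star> f)"
proof (rule neg_unique)
  note n = neg_in_Hom[OF assms(1)]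
  show "g \<star> neg f \<in> Hom C X Z" "g \<star> f \<in> Hom C X Z" using comp_in_Hom n assms by blast+
  show "(g \<star> neg f) \<boxplus> (g \<star> f) = Zero C X Z"
    using comp_add_right[OF n assms] add_neg_left[OF assms(1)] comp_zero_right[OF _ assms(2)]
      Hom_Obj assms(1) by metis
qed

lemma comp_neg_left:
  assumes "f \<in> Hom C X Y" "g \<in> Hom C Y Z"
  shows "neg g \<star> f = neg (g \<star> f)"
proof (rule neg_unique)
  note n = neg_in_Hom[OF assms(2)]
  show "neg g \<star> f \<in> Hom C X Z" "g \<star> f \<in> Hom C X Z" using comp_in_Hom n assms by blast+
  show "(neg g \<star> f) \<boxplus> (g \<star> f) = Zero C X Z"
    using comp_add_left[OF assms(1) n assms(2)] add_neg_left[OF assms(2)] comp_zero_left[OF _ assms(1)]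
      Hom_Obj assms(2) by metis
qed

lemma diff_add_cancel:
  assumes "f \<in> Hom C X Y" "g \<in> Hom C X Y"
  shows "(f \<boxplus> neg g) \<boxplus> g = f"
  using add_assoc[OF assms(1) neg_in_Hom[OF assms(2)] assms(2)] add_neg_left[OF assms(2)]
    add_zero_right[OF assms(1)] by simp

lemma add_diff_cancel:
  assumes "f \<in> Hom C X Y" "g \<in> Hom C X Y"
  shows "(f \<boxplus> g) \<boxplus> neg g = f"
  using add_assoc[OF assms neg_in_Hom[OF assms(2)]] add_neg_right[OF assms(2)]
    add_zero_right[OF assms(1)] by simp

lemma comp_diff_right:
  assumes "f \<in> Hom C X Y" "g \<in> Hom C X Y" "k \<in> Hom C Y Z"
  shows "k \<star> (f \<boxplus> neg g) = (k \<star> f) \<boxplus> neg (k \<star> g)"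
  using comp_add_right[OF assms(1) neg_in_Hom assms(3)] comp_neg_right assms by auto

lemma comp_diff_left:
  assumes "f \<in> Hom C Y Z" "g \<in> Hom C Y Z" "k \<in> Hom C X Y"
  shows "(f \<boxplus> neg g) \<star> k = (f \<star> k) \<boxplus> neg (g \<star> k)"
  using comp_add_left[OF assms(3,1) neg_in_Hom] comp_neg_left assms by auto

end

section \<open>Cosets modulo a two-sided ideal\<close>

locale preadditive_quotient = preadditive_category C
  for C :: "('o, 'm, 'z) preadditive_scheme" (structure) and I :: "'o \<Rightarrow> 'o \<Rightarrow> 'm set" +
  assumes ideal_subgroup: "\<lbrakk>X \<in> Obj C; Y \<in> Obj C\<rbrakk> \<Longrightarrow> subgroup (I X Y) (hom_group C X Y)"
    and ideal_comp_left: "\<lbrakk>f \<in> I X Y; g \<in> Hom C Y Z; X \<in> Obj C\<rbrakk> \<Longrightarrow> g \<star> f \<in> I X Z"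
    and ideal_comp_right: "\<lbrakk>f \<in> Hom C X Y; g \<in> I Y Z; Z \<in> Obj C\<rbrakk> \<Longrightarrow> g \<star> f \<in> I X Z"
begin

abbreviation Q where "Q \<equiv> additive_quotient C I"

text \<open>The local \<open>coset\<close> of \<open>additive_quotient\<close>, named so that every
  morphism of the quotient can be written as \<open>cls f\<close>.\<close>

definition cls :: "'m \<Rightarrow> 'm set" where
  "cls f = I (Dom C f) (Cod C f) #>\<^bsub>hom_group C (Dom C f) (Cod C f)\<^esub> f"

lemma ideal_in_Hom: "\<lbrakk>X \<in> Obj C; Y \<in> Obj C; f \<in> I X Y\<rbrakk> \<Longrightarrow> f \<in> Hom C X Y"
  using subgroup.subset[OF ideal_subgroup] by (auto simp: hom_group_simps)

lemma ideal_zero: "\<lbrakk>X \<in> Obj C; Y \<in> Obj C\<rbrakk> \<Longrightarrow> Zero C X Y \<in> I X Y"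
  using subgroup.one_closed[OF ideal_subgroup, of X Y] by (auto simp: hom_group_simps)

lemma cls_alt: "f \<in> Hom C X Y \<Longrightarrow> cls f = {t \<boxplus> f | t. t \<in> I X Y}"
  unfolding cls_def r_coset_def using Hom_D by (fastforce simp: hom_group_simps)

lemma self_in_cls: "f \<in> Hom C X Y \<Longrightarrow> f \<in> cls f"
  using Hom_Obj[of f X Y] ideal_zero[of X Y] add_zero_left[of f X Y, symmetric] by (auto simp: cls_alt)

lemma cls_Hom: "\<lbrakk>f \<in> Hom C X Y; g \<in> cls f\<rbrakk> \<Longrightarrow> g \<in> Hom C X Y"
  using Hom_Obj[of f X Y] ideal_in_Hom[of X Y] add_in_Hom by (fastforce simp: cls_alt)

lemma cls_eqI:
  assumes "f \<in> Hom C X Y" "g \<in> cls f"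
  shows "cls g = cls f"
proof -
  have X: "X \<in> Obj C" "Y \<in> Obj C" using Hom_Obj assms by auto
  have "I X Y #>\<^bsub>hom_group C X Y\<^esub> f = I X Y #>\<^bsub>hom_group C X Y\<^esub> g"
    using group.repr_independence[OF hom_group[OF X] _ _ ideal_subgroup[OF X], of g f] assms
    by (auto simp: hom_group_simps cls_def Hom_def)
  then show ?thesis using Hom_D[OF assms(1)] Hom_D[OF cls_Hom[OF assms]] by (simp add: cls_def)
qed

lemma cls_eq_iff:
  assumes "f \<in> Hom C X Y" "g \<in> Hom C X Y"
  shows "cls f = cls g \<longleftrightarrow> (\<exists>t \<in> I X Y. f = t \<boxplus> g)"
proof
  assume "cls f = cls g"
  then show "\<exists>t \<in> I X Y. f = t \<boxplus> g" using self_in_cls[OF assms(1)] cls_alt[OF assms(2)] by auto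
next
  assume "\<exists>t \<in> I X Y. f = t \<boxplus> g"
  then show "cls f = cls g" using cls_eqI[OF assms(2)] cls_alt[OF assms(2)] by auto
qed

lemma cls_eq_iff_diff:
  assumes "f \<in> Hom C X Y" "g \<in> Hom C X Y"
  shows "cls f = cls g \<longleftrightarrow> f \<boxplus> neg g \<in> I X Y"
proof
  have X: "X \<in> Obj C" "Y \<in> Obj C" using Hom_Obj assms by auto
  assume "cls f = cls g"
  then obtain t where t: "t \<in> I X Y" "f = t \<boxplus> g" using cls_eq_iff[OF assms] by auto
  then show "f \<boxplus> neg g \<in> I X Y" using add_diff_cancel[OF ideal_in_Hom[OF X t(1)] assms(2)] by simp
next
  assume "f \<boxplus> neg g \<in> I X Y"
  then show "cls f = cls g" using diff_add_cancel[OF assms] cls_eq_iff[OF assms] by metis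
qed

lemma Q_unfold:
  "Obj Q = Obj C"
  "Arr Q = (\<Union>X \<in> Obj C. \<Union>Y \<in> Obj C. carrier (hom_group C X Y Mod I X Y))"
  "Dom Q F = Dom C (SOME f. f \<in> F)" "Cod Q F = Cod C (SOME f. f \<in> F)"
  "Ide Q X = cls (Ide C X)"
  "G \<star>\<^bsub>Q\<^esub> F = cls ((SOME g. g \<in> G) \<star> (SOME f. f \<in> F))"
  by (simp_all add: additive_quotient_def Let_def cls_def)

lemma carrier_Mod: "carrier (hom_group C X Y Mod I X Y) = cls ` Hom C X Y"
  by (auto simp: FactGroup_def RCOSETS_def hom_group_simps cls_def Hom_def)

lemma Arr_Q: "Arr Q = cls ` Arr C"
  using dom_in_Obj cod_in_Obj unfolding Q_unfold carrier_Mod by (auto simp: Hom_def)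

lemma rep_cls:
  assumes "f \<in> Hom C X Y"
  shows "(SOME g. g \<in> cls f) \<in> Hom C X Y" "cls (SOME g. g \<in> cls f) = cls f"
proof -
  have "(SOME g. g \<in> cls f) \<in> cls f" using self_in_cls[OF assms] some_in_eq[of "cls f"] by blast
  then show "(SOME g. g \<in> cls f) \<in> Hom C X Y" "cls (SOME g. g \<in> cls f) = cls f"
    by (rule cls_Hom[OF assms], rule cls_eqI[OF assms])
qed

lemma Dom_Cod_Q: "f \<in> Hom C X Y \<Longrightarrow> Dom Q (cls f) = X" "f \<in> Hom C X Y \<Longrightarrow> Cod Q (cls f) = Y"
  using Hom_D[OF rep_cls(1)] by (auto simp: Q_unfold)

lemma Hom_Q: "Hom Q X Y = cls ` Hom C X Y"
proof -
  have "F \<in> Hom Q X Y \<longleftrightarrow> F \<in> cls ` Hom C X Y" for F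
  proof
    assume F: "F \<in> Hom Q X Y"
    then obtain f where f: "F = cls f" "f \<in> Arr C" using Hom_D[OF F] unfolding Arr_Q by blast
    then have fH: "f \<in> Hom C (Dom C f) (Cod C f)" by (simp add: Hom_def)
    have "Dom C f = X" "Cod C f = Y" using Hom_D[OF F] Dom_Cod_Q[OF fH] unfolding f(1) by auto
    with fH f(1) show "F \<in> cls ` Hom C X Y" by blast
  next
    assume "F \<in> cls ` Hom C X Y"
    then obtain f where f: "F = cls f" "f \<in> Hom C X Y" by blast
    have "F \<in> Arr Q" unfolding f(1) Arr_Q using Hom_D[OF f(2)] by blast
    then show "F \<in> Hom Q X Y" using Dom_Cod_Q[OF f(2)] unfolding Hom_def[of Q] f(1) by blast
  qed
  then show ?thesis by blast
qed

text \<open>The two sides of the ideal are used in turn: first \<open>f\<close> is exchanged with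
  \<open>g\<close> fixed, then \<open>g\<close> with \<open>f'\<close> fixed.\<close>

lemma cls_comp_cong:
  assumes f: "f \<in> Hom C X Y" "f' \<in> Hom C X Y" "cls f = cls f'"
    and g: "g \<in> Hom C Y Z" "g' \<in> Hom C Y Z" "cls g = cls g'"
  shows "cls (g \<star> f) = cls (g' \<star> f')"
proof -
  have X: "X \<in> Obj C" "Y \<in> Obj C" "Z \<in> Obj C" using Hom_Obj f g by auto
  have "g \<star> (f \<boxplus> neg f') \<in> I X Z"
    using cls_eq_iff_diff[OF f(1,2)] f(3) g(1) X ideal_comp_left by blast
  then have 1: "cls (g \<star> f) = cls (g \<star> f')"
    unfolding comp_diff_right[OF f(1,2) g(1)]
    using cls_eq_iff_diff[OF comp_in_Hom[OF f(1) g(1)] comp_in_Hom[OF f(2) g(1)]] by simp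
  have "(g \<boxplus> neg g') \<star> f' \<in> I X Z"
    using cls_eq_iff_diff[OF g(1,2)] g(3) f(2) X ideal_comp_right by blast
  then have "cls (g \<star> f') = cls (g' \<star> f')"
    unfolding comp_diff_left[OF g(1,2) f(2)]
    using cls_eq_iff_diff[OF comp_in_Hom[OF f(2) g(1)] comp_in_Hom[OF f(2) g(2)]] by simp
  with 1 show ?thesis by simp
qed

lemma Comp_Q:
  assumes "f \<in> Hom C X Y" "g \<in> Hom C Y Z"
  shows "cls g \<star>\<^bsub>Q\<^esub> cls f = cls (g \<star> f)"
  unfolding Q_unfold using rep_cls assms by (intro cls_comp_cong) auto

lemma category_Q: "category Q"
proof
  fix f assume "f \<in> Arr Q"
  then obtain f' where f: "f = cls f'" "f' \<in> Hom C (Dom C f') (Cod C f')"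
    by (auto simp: Arr_Q Hom_def)
  then show "Dom Q f \<in> Obj Q" "Cod Q f \<in> Obj Q"
    using Dom_Cod_Q[OF f(2)] Hom_Obj[OF f(2)] by (auto simp: Q_unfold(1))
next
  fix X assume "X \<in> Obj Q"
  then show "Ide Q X \<in> Hom Q X X" using ide_in_Hom by (simp add: Hom_Q Q_unfold(1,5))
next
  fix f X Y g Z assume "f \<in> Hom Q X Y" "g \<in> Hom Q Y Z"
  then show "g \<star>\<^bsub>Q\<^esub> f \<in> Hom Q X Z" using comp_in_Hom by (fastforce simp: Hom_Q Comp_Q)
next
  fix f X Y assume "f \<in> Hom Q X Y"
  then obtain f' where f: "f = cls f'" "f' \<in> Hom C X Y" by (auto simp: Hom_Q)
  then have X: "X \<in> Obj C" "Y \<in> Obj C" using Hom_Obj by auto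
  show "f \<star>\<^bsub>Q\<^esub> Ide Q X = f"
    using Comp_Q[OF ide_in_Hom[OF X(1)] f(2)] f(1) comp_ide_right[OF f(2)] by (simp add: Q_unfold(5))
  show "Ide Q Y \<star>\<^bsub>Q\<^esub> f = f"
    using Comp_Q[OF f(2) ide_in_Hom[OF X(2)]] f(1) comp_ide_left[OF f(2)] by (simp add: Q_unfold(5))
next
  fix f W X g Y h Z
  assume "f \<in> Hom Q W X" "g \<in> Hom Q X Y" "h \<in> Hom Q Y Z"
  then obtain f' g' h' where f: "f = cls f'" "f' \<in> Hom C W X" and g: "g = cls g'" "g' \<in> Hom C X Y"
    and h: "h = cls h'" "h' \<in> Hom C Y Z" by (auto simp: Hom_Q)
  show "(h \<star>\<^bsub>Q\<^esub> g) \<star>\<^bsub>Q\<^esub> f = h \<star>\<^bsub>Q\<^esub> (g \<star>\<^bsub>Q\<^esub> f)"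
    unfolding f(1) g(1) h(1) Comp_Q[OF f(2) g(2)] Comp_Q[OF g(2) h(2)]
      Comp_Q[OF f(2) comp_in_Hom[OF g(2) h(2)]] Comp_Q[OF comp_in_Hom[OF f(2) g(2)] h(2)]
    by (simp add: comp_assoc[OF f(2) g(2) h(2)])
qed

lemma cls_eq_zero_iff: "f \<in> Hom C X Y \<Longrightarrow> cls f = cls (Zero C X Y) \<longleftrightarrow> f \<in> I X Y"
  using cls_eq_iff[of f X Y "Zero C X Y"] zero_in_Hom[of X Y] Hom_Obj[of f X Y]
    add_zero_right[OF ideal_in_Hom] by fastforce

text \<open>By additivity, cancellation need only be tested on morphisms whose composite becomes
  zero, and becoming zero means lying in the ideal. This moves monicity from the quotient back into
  \<open>C\<close>, where the arguments with extensions take place.\<close>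

lemma monomorphism_cls_iff:
  assumes f: "f \<in> Hom C X Y"
  shows "monomorphism Q (cls f) \<longleftrightarrow> (\<forall>Z u. u \<in> Hom C Z X \<longrightarrow> f \<star> u \<in> I Z Y \<longrightarrow> u \<in> I Z X)"
    (is "?M \<longleftrightarrow> ?K")
proof
  assume M: ?M
  show ?K
  proof (intro allI impI)
    fix Z u assume u: "u \<in> Hom C Z X" and fu: "f \<star> u \<in> I Z Y"
    have Z: "Z \<in> Obj C" "X \<in> Obj C" using Hom_Obj u by auto
    note z = zero_in_Hom[OF Z]
    have "cls (f \<star> u) = cls (Zero C Z Y)"
      using cls_eq_zero_iff[OF comp_in_Hom[OF u f]] fu by simp
    then have "cls f \<star>\<^bsub>Q\<^esub> cls u = cls f \<star>\<^bsub>Q\<^esub> cls (Zero C Z X)"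
      by (simp add: Comp_Q[OF u f] Comp_Q[OF z f] comp_zero_right[OF Z(1) f])
    moreover have "cls u \<in> Hom Q Z (Dom Q (cls f))" "cls (Zero C Z X) \<in> Hom Q Z (Dom Q (cls f))"
      using u z by (auto simp: Hom_Q Dom_Cod_Q[OF f])
    moreover have "Z \<in> Obj Q" using Z by (simp add: Q_unfold(1))
    ultimately have "cls u = cls (Zero C Z X)" using M unfolding monomorphism_def by metis
    then show "u \<in> I Z X" using cls_eq_zero_iff[OF u] by simp
  qed
next
  assume K: ?K
  show ?M unfolding monomorphism_def
  proof (intro conjI ballI impI)
    show "cls f \<in> Arr Q" using Hom_D[OF f] Arr_Q by auto
    fix Z g h assume "Z \<in> Obj Q" "g \<in> Hom Q Z (Dom Q (cls f))" "h \<in> Hom Q Z (Dom Q (cls f))"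
      and eq: "cls f \<star>\<^bsub>Q\<^esub> g = cls f \<star>\<^bsub>Q\<^esub> h"
    then obtain g' h' where g: "g = cls g'" "g' \<in> Hom C Z X" and h: "h = cls h'" "h' \<in> Hom C Z X"
      by (auto simp: Hom_Q Dom_Cod_Q[OF f])
    have "cls (f \<star> g') = cls (f \<star> h')"
      using eq by (simp add: g(1) h(1) Comp_Q[OF g(2) f] Comp_Q[OF h(2) f])
    then have "f \<star> (g' \<boxplus> neg h') \<in> I Z Y"
      using cls_eq_iff_diff[OF comp_in_Hom[OF g(2) f] comp_in_Hom[OF h(2) f]]
        comp_diff_right[OF g(2) h(2) f] by simp
    then have "g' \<boxplus> neg h' \<in> I Z X" using K add_in_Hom[OF g(2) neg_in_Hom[OF h(2)]] by blast
    then show "g = h" using cls_eq_iff_diff[OF g(2) h(2)] g(1) h(1) by simp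
  qed
qed

lemma epimorphism_cls_iff:
  assumes f: "f \<in> Hom C X Y"
  shows "epimorphism Q (cls f) \<longleftrightarrow> (\<forall>Z u. u \<in> Hom C Y Z \<longrightarrow> u \<star> f \<in> I X Z \<longrightarrow> u \<in> I Y Z)"
    (is "?M \<longleftrightarrow> ?K")
proof
  assume M: ?M
  show ?K
  proof (intro allI impI)
    fix Z u assume u: "u \<in> Hom C Y Z" and fu: "u \<star> f \<in> I X Z"
    have Z: "Y \<in> Obj C" "Z \<in> Obj C" using Hom_Obj u by auto
    note z = zero_in_Hom[OF Z]
    have "cls (u \<star> f) = cls (Zero C X Z)"
      using cls_eq_zero_iff[OF comp_in_Hom[OF f u]] fu by simp
    then have "cls u \<star>\<^bsub>Q\<^esub> cls f = cls (Zero C Y Z) \<star>\<^bsub>Q\<^esub> cls f"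
      by (simp add: Comp_Q[OF f u] Comp_Q[OF f z] comp_zero_left[OF Z(2) f])
    moreover have "cls u \<in> Hom Q (Cod Q (cls f)) Z" "cls (Zero C Y Z) \<in> Hom Q (Cod Q (cls f)) Z"
      using u z by (auto simp: Hom_Q Dom_Cod_Q[OF f])
    moreover have "Z \<in> Obj Q" using Z by (simp add: Q_unfold(1))
    ultimately have "cls u = cls (Zero C Y Z)" using M unfolding epimorphism_def by metis
    then show "u \<in> I Y Z" using cls_eq_zero_iff[OF u] by simp
  qed
next
  assume K: ?K
  show ?M unfolding epimorphism_def
  proof (intro conjI ballI impI)
    show "cls f \<in> Arr Q" using Hom_D[OF f] Arr_Q by auto
    fix Z g h assume "Z \<in> Obj Q" "g \<in> Hom Q (Cod Q (cls f)) Z" "h \<in> Hom Q (Cod Q (cls f)) Z"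
      and eq: "g \<star>\<^bsub>Q\<^esub> cls f = h \<star>\<^bsub>Q\<^esub> cls f"
    then obtain g' h' where g: "g = cls g'" "g' \<in> Hom C Y Z" and h: "h = cls h'" "h' \<in> Hom C Y Z"
      by (auto simp: Hom_Q Dom_Cod_Q[OF f])
    have "cls (g' \<star> f) = cls (h' \<star> f)"
      using eq by (simp add: g(1) h(1) Comp_Q[OF f g(2)] Comp_Q[OF f h(2)])
    then have "(g' \<boxplus> neg h') \<star> f \<in> I X Z"
      using cls_eq_iff_diff[OF comp_in_Hom[OF f g(2)] comp_in_Hom[OF f h(2)]]
        comp_diff_left[OF g(2) h(2) f] by simp
    then have "g' \<boxplus> neg h' \<in> I Y Z" using K add_in_Hom[OF g(2) neg_in_Hom[OF h(2)]] by blast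
    then show "g = h" using cls_eq_iff_diff[OF g(2) h(2)] g(1) h(1) by simp
  qed
qed

end

section \<open>Full subcategories\<close>

lemma Hom_full_subcategory:
  "Hom (full_subcategory C H) X Y = (if X \<in> H \<and> Y \<in> H then Hom C X Y else {})"
  by (auto simp: Hom_def full_subcategory_def)

lemma full_subcategory_simps:
  "Obj (full_subcategory C H) = H" "Ide (full_subcategory C H) = Ide C"
  "Comp (full_subcategory C H) = Comp C" "Dom (full_subcategory C H) = Dom C"
  "Cod (full_subcategory C H) = Cod C"
  by (simp_all add: full_subcategory_def)

lemma hom_group_full_subcategory:
  "\<lbrakk>X \<in> H; Y \<in> H\<rbrakk> \<Longrightarrow> hom_group (full_subcategory C H) X Y = hom_group C X Y"
  by (simp add: hom_group_def Hom_full_subcategory) (simp add: full_subcategory_def)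

lemma (in preadditive_category) preadditive_full_subcategory:
  assumes "H \<subseteq> Obj C"
  shows "preadditive_category (full_subcategory C H)"
proof -
  have A: "Add (full_subcategory C H) = Add C" by (simp add: full_subcategory_def)
  show ?thesis
  proof (intro preadditive_category.intro category.intro preadditive_category_axioms.intro)
    show "\<And>X. X \<in> Obj (full_subcategory C H) \<Longrightarrow>
        Ide (full_subcategory C H) X \<in> Hom (full_subcategory C H) X X"
      using ide_in_Hom assms by (auto simp: Hom_full_subcategory full_subcategory_simps)
    show "\<And>X Y. X \<in> Obj (full_subcategory C H) \<Longrightarrow> Y \<in> Obj (full_subcategory C H) \<Longrightarrow>
        comm_group (hom_group (full_subcategory C H) X Y)"
      using hom_comm_group assms by (auto simp: hom_group_full_subcategory full_subcategory_simps)
    show "\<And>f. f \<in> Arr (full_subcategory C H) \<Longrightarrow>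
        Dom (full_subcategory C H) f \<in> Obj (full_subcategory C H)"
      "\<And>f. f \<in> Arr (full_subcategory C H) \<Longrightarrow>
        Cod (full_subcategory C H) f \<in> Obj (full_subcategory C H)"
      by (simp_all add: full_subcategory_def)
  qed (auto simp: Hom_full_subcategory full_subcategory_simps A comp_in_Hom comp_ide_right
      comp_ide_left comp_assoc comp_add_left comp_add_right split: if_splits)
qed

text \<open>An equality of records and not just an equivalence, so that a heart with all objects of
  B can be rewritten to a quotient of B itself.\<close>

lemma (in category) full_subcategory_Obj:
  "full_subcategory C (Obj C) = C"
proof -
  have "{f \<in> Arr C. Dom C f \<in> Obj C \<and> Cod C f \<in> Obj C} = Arr C"
    using dom_in_Obj cod_in_Obj by auto
  then show ?thesis by (simp add: full_subcategory_def)
qed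

section \<open>The ideal of morphisms that factor through a subcategory\<close>

context additive_category
begin

lemma factoring_idealI:
  "\<lbrakk>Z \<in> W; u \<in> Hom C X Z; v \<in> Hom C Z Y\<rbrakk> \<Longrightarrow> v \<star> u \<in> factoring_ideal C W X Y"
  by (auto simp: factoring_ideal_def)

lemma factoring_idealE:
  assumes "f \<in> factoring_ideal C W X Y"
  obtains u v Z where "Z \<in> W" "u \<in> Hom C X Z" "v \<in> Hom C Z Y" "f = v \<star> u"
  using assms by (auto simp: factoring_ideal_def)

lemma factoring_ideal_in_Hom: "f \<in> factoring_ideal C W X Y \<Longrightarrow> f \<in> Hom C X Y"
  using comp_in_Hom by (auto simp: factoring_ideal_def)

lemma factoring_ideal_comp_left:
  assumes "f \<in> factoring_ideal C W X Y" "g \<in> Hom C Y Z"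
  shows "g \<star> f \<in> factoring_ideal C W X Z"
  using assms(1)
proof (rule factoring_idealE)
  fix u v P assume h: "P \<in> W" "u \<in> Hom C X P" "v \<in> Hom C P Y" "f = v \<star> u"
  then show ?thesis
    using factoring_idealI[OF h(1,2) comp_in_Hom[OF h(3) assms(2)]] comp_assoc[OF h(2,3) assms(2)]
    by simp
qed

lemma factoring_ideal_comp_right:
  assumes "g \<in> factoring_ideal C W Y Z" "f \<in> Hom C X Y"
  shows "g \<star> f \<in> factoring_ideal C W X Z"
  using assms(1)
proof (rule factoring_idealE)
  fix u v P assume h: "P \<in> W" "u \<in> Hom C Y P" "v \<in> Hom C P Z" "g = v \<star> u"
  then show ?thesis
    using factoring_idealI[OF h(1) comp_in_Hom[OF assms(2) h(2)] h(3)] comp_assoc[OF assms(2) h(2,3)]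
    by simp
qed

text \<open>Factorisations through \<open>A\<close> and \<open>A'\<close> combine into one through
  their direct sum; here \<open>W\<close> must be closed under direct sums.\<close>

lemma factoring_ideal_add:
  assumes W: "additive_subcategory C W"
    and "f \<in> factoring_ideal C W X Y" "g \<in> factoring_ideal C W X Y"
  shows "f \<boxplus> g \<in> factoring_ideal C W X Y"
proof -
  obtain u v A where f: "A \<in> W" "u \<in> Hom C X A" "v \<in> Hom C A Y" "f = v \<star> u"
    using assms factoring_idealE by metis
  obtain u' v' A' where g: "A' \<in> W" "u' \<in> Hom C X A'" "v' \<in> Hom C A' Y" "g = v' \<star> u'"
    using assms factoring_idealE by metis
  have X: "A \<in> Obj C" "A' \<in> Obj C" "X \<in> Obj C" "Y \<in> Obj C" using f g Hom_Obj by auto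
  obtain P i i' p p' where bi: "biproduct C A A' P i i' p p'" using has_biproducts[OF X(1,2)] by blast
  then have PW: "P \<in> W" using W f g unfolding additive_subcategory_def by blast
  from bi have i: "i \<in> Hom C A P" "i' \<in> Hom C A' P" and p: "p \<in> Hom C P A" "p' \<in> Hom C P A'"
    and e: "p \<star> i = Ide C A" "p' \<star> i' = Ide C A'" "p \<star> i' = Zero C A' A" "p' \<star> i = Zero C A A'"
    by (auto simp: biproduct_def)
  define a where "a = (i \<star> u) \<boxplus> (i' \<star> u')"
  define b where "b = (v \<star> p) \<boxplus> (v' \<star> p')"
  have iu: "i \<star> u \<in> Hom C X P" "i' \<star> u' \<in> Hom C X P" using comp_in_Hom i f g by blast+
  have vp: "v \<star> p \<in> Hom C P Y" "v' \<star> p' \<in> Hom C P Y" using comp_in_Hom p f g by blast+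
  have aH: "a \<in> Hom C X P" unfolding a_def by (rule add_in_Hom[OF iu])
  have bH: "b \<in> Hom C P Y" unfolding b_def by (rule add_in_Hom[OF vp])
  have pa: "p \<star> a = u"
    using comp_add_right[OF iu p(1)] comp_assoc[OF f(2) i(1) p(1)] comp_assoc[OF g(2) i(2) p(1)]
      e comp_ide_left[OF f(2)] comp_zero_left[OF X(1) g(2)] add_zero_right[OF f(2)] by (simp add: a_def)
  have p'a: "p' \<star> a = u'"
    using comp_add_right[OF iu p(2)] comp_assoc[OF f(2) i(1) p(2)] comp_assoc[OF g(2) i(2) p(2)]
      e comp_ide_left[OF g(2)] comp_zero_left[OF X(2) f(2)] add_zero_left[OF g(2)] by (simp add: a_def)
  have "b \<star> a = (v \<star> u) \<boxplus> (v' \<star> u')"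
    unfolding b_def comp_add_left[OF aH vp] comp_assoc[OF aH p(1) f(3)] comp_assoc[OF aH p(2) g(3)] pa p'a ..
  then show ?thesis using factoring_idealI[OF PW aH bH] f g by simp
qed

lemma factoring_ideal_zero:
  assumes W: "additive_subcategory C W" and X: "X \<in> Obj C" "Y \<in> Obj C"
  shows "Zero C X Y \<in> factoring_ideal C W X Y"
proof -
  obtain Z where Z: "Z \<in> W" "Z \<in> Obj C" using W unfolding additive_subcategory_def zero_object_def by blast
  show ?thesis
    using factoring_idealI[OF Z(1) zero_in_Hom[OF X(1) Z(2)] zero_in_Hom[OF Z(2) X(2)]]
      comp_zero_right[OF X(1) zero_in_Hom[OF Z(2) X(2)]] by simp
qed

lemma factoring_ideal_neg:
  assumes "f \<in> factoring_ideal C W X Y"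
  shows "neg f \<in> factoring_ideal C W X Y"
  using assms
proof (rule factoring_idealE)
  fix u v P assume h: "P \<in> W" "u \<in> Hom C X P" "v \<in> Hom C P Y" "f = v \<star> u"
  then show ?thesis
    using factoring_idealI[OF h(1) neg_in_Hom[OF h(2)] h(3)] comp_neg_right[OF h(2,3)] by simp
qed

lemma factoring_ideal_subgroup:
  assumes W: "additive_subcategory C W" and X: "X \<in> Obj C" "Y \<in> Obj C"
  shows "subgroup (factoring_ideal C W X Y) (hom_group C X Y)"
proof
  show "factoring_ideal C W X Y \<subseteq> carrier (hom_group C X Y)"
    using factoring_ideal_in_Hom by (auto simp: hom_group_simps)
  show "\<one>\<^bsub>hom_group C X Y\<^esub> \<in> factoring_ideal C W X Y"
    using factoring_ideal_zero[OF assms] by (simp add: hom_group_simps)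
  fix x y assume x: "x \<in> factoring_ideal C W X Y"
  show "inv\<^bsub>hom_group C X Y\<^esub> x \<in> factoring_ideal C W X Y"
    using factoring_ideal_neg[OF x] Hom_D[OF factoring_ideal_in_Hom[OF x]] by (simp add: neg_def)
  assume "y \<in> factoring_ideal C W X Y"
  then show "x \<otimes>\<^bsub>hom_group C X Y\<^esub> y \<in> factoring_ideal C W X Y"
    using factoring_ideal_add[OF W x] by (simp add: hom_group_simps)
qed

text \<open>The factorisations run in \<open>C\<close> and not in the full subcategory, as in the
  definition of \<open>heart\<close>.\<close>

lemma preadditive_quotient_factoring_ideal:
  assumes W: "additive_subcategory C W" and H: "H \<subseteq> Obj C"
  shows "preadditive_quotient (full_subcategory C H) (factoring_ideal C W)"
proof -
  interpret H: preadditive_category "full_subcategory C H"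
    by (rule preadditive_full_subcategory[OF H])
  show ?thesis
  proof (intro preadditive_quotient.intro preadditive_quotient_axioms.intro H.preadditive_category_axioms)
    show "\<And>X Y. X \<in> Obj (full_subcategory C H) \<Longrightarrow> Y \<in> Obj (full_subcategory C H) \<Longrightarrow>
        subgroup (factoring_ideal C W X Y) (hom_group (full_subcategory C H) X Y)"
      using factoring_ideal_subgroup[OF W] H
      by (auto simp: hom_group_full_subcategory full_subcategory_simps)
  qed (auto simp: Hom_full_subcategory full_subcategory_simps split: if_splits
      intro: factoring_ideal_comp_left factoring_ideal_comp_right)
qed

end

section \<open>Exact sequences in extriangulated categories\<close>

lemma (in preadditive_category) biproduct_swap:
  assumes "biproduct C A A' P i i' p p'"
  shows "biproduct C A' A P i' i p' p"
proof -
  have "i \<star> p \<in> Hom C P P" "i' \<star> p' \<in> Hom C P P"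
    using assms comp_in_Hom unfolding biproduct_def by blast+
  then show ?thesis using assms add_commute unfolding biproduct_def by auto
qed

lemma (in preadditive_category) zero_object_Hom:
  assumes "zero_object C Z" "X \<in> Obj C"
  shows "f \<in> Hom C X Z \<Longrightarrow> f = Zero C X Z" "f \<in> Hom C Z X \<Longrightarrow> f = Zero C Z X"
  using assms zero_in_Hom unfolding zero_object_def by blast+

lemma (in preadditive_category) biproduct_zero_object:
  assumes Z: "zero_object C Z" and X: "X \<in> Obj C"
  shows "biproduct C X Z X (Ide C X) (Zero C Z X) (Ide C X) (Zero C X Z)"
proof -
  have ZO: "Z \<in> Obj C" using Z by (simp add: zero_object_def)
  note i = ide_in_Hom[OF X] and z = zero_in_Hom[OF ZO X] zero_in_Hom[OF X ZO] zero_in_Hom[OF X X]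
  have "Zero C X Z \<star> Zero C Z X = Ide C Z"
    using zero_object_Hom[OF Z ZO] comp_in_Hom[OF z(1,2)] ide_in_Hom[OF ZO] by metis
  then show ?thesis
    using X ZO i z comp_ide_left[OF i] comp_ide_left[OF z(1)] comp_ide_right[OF z(2)]
      comp_zero_right[OF X z(1)] add_zero_right[OF i] unfolding biproduct_def by simp
qed

text \<open>The direct sum is transported along the shear \<open>1 + i f p'\<close>, which fixes
  \<open>i\<close> and moves \<open>i'\<close> to the graph of \<open>f\<close>. The summands are
  exchanged so that \<open>real_zero\<close> makes the graph a split inflation.\<close>

lemma (in preadditive_category) biproduct_shear:
  assumes bi: "biproduct C Y X P i i' p p'" and f: "f \<in> Hom C X Y"
  shows "biproduct C X Y P ((i \<star> f) \<boxplus> i') i p' (p \<boxplus> neg (f \<star> p'))"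
proof -
  from bi have X: "Y \<in> Obj C" "X \<in> Obj C" "P \<in> Obj C"
    and i: "i \<in> Hom C Y P" "i' \<in> Hom C X P" and p: "p \<in> Hom C P Y" "p' \<in> Hom C P X"
    and e: "p \<star> i = Ide C Y" "p' \<star> i' = Ide C X" "p \<star> i' = Zero C X Y" "p' \<star> i = Zero C Y X"
    and sum: "(i \<star> p) \<boxplus> (i' \<star> p') = Ide C P"
    by (auto simp: biproduct_def)
  note if' = comp_in_Hom[OF f i(1)] and fp = comp_in_Hom[OF p(2) f]
  note m = add_in_Hom[OF if' i(2)] and n = add_in_Hom[OF p(1) neg_in_Hom[OF fp]]
  have 1: "p' \<star> ((i \<star> f) \<boxplus> i') = Ide C X"
    using comp_add_right[OF if' i(2) p(2)] comp_assoc[OF f i(1) p(2)] e comp_zero_left[OF X(2) f]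
      add_zero_left[OF ide_in_Hom[OF X(2)]] by simp
  have pm: "p \<star> ((i \<star> f) \<boxplus> i') = f"
    using comp_add_right[OF if' i(2) p(1)] comp_assoc[OF f i(1) p(1)] e comp_ide_left[OF f]
      add_zero_right[OF f] by simp
  have 2: "(p \<boxplus> neg (f \<star> p')) \<star> i = Ide C Y"
    using comp_diff_left[OF p(1) fp i(1)] comp_assoc[OF i(1) p(2) f] e comp_zero_right[OF X(1) f]
      diff_add_cancel[OF ide_in_Hom[OF X(1)] zero_in_Hom[OF X(1) X(1)]]
      add_zero_right[OF add_in_Hom[OF ide_in_Hom[OF X(1)] neg_in_Hom[OF zero_in_Hom[OF X(1) X(1)]]]]
    by simp
  have 3: "(p \<boxplus> neg (f \<star> p')) \<star> ((i \<star> f) \<boxplus> i') = Zero C X Y"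
    using comp_diff_left[OF p(1) fp m] comp_assoc[OF m p(2) f] pm 1 comp_ide_right[OF f]
      add_neg_right[OF f] by simp
  note ifp = comp_in_Hom[OF fp i(1)] and ip = comp_in_Hom[OF p(1) i(1)] and i'p' = comp_in_Hom[OF p(2) i(2)]
  have "(((i \<star> f) \<boxplus> i') \<star> p') \<boxplus> (i \<star> (p \<boxplus> neg (f \<star> p')))
      = ((i \<star> (f \<star> p')) \<boxplus> (i' \<star> p')) \<boxplus> ((i \<star> p) \<boxplus> neg (i \<star> (f \<star> p')))"
    using comp_add_left[OF p(2) if' i(2)] comp_diff_right[OF p(1) fp i(1)] comp_assoc[OF p(2) f i(1)]
    by simp
  also have "\<dots> = ((i' \<star> p') \<boxplus> (i \<star> (f \<star> p'))) \<boxplus> (neg (i \<star> (f \<star> p')) \<boxplus> (i \<star> p))"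
    using add_commute[OF ifp i'p'] add_commute[OF ip neg_in_Hom[OF ifp]] by simp
  also have "\<dots> = (i' \<star> p') \<boxplus> (((i \<star> (f \<star> p')) \<boxplus> neg (i \<star> (f \<star> p'))) \<boxplus> (i \<star> p))"
    using add_assoc[OF i'p' ifp add_in_Hom[OF neg_in_Hom[OF ifp] ip]]
      add_assoc[OF ifp neg_in_Hom[OF ifp] ip] by simp
  also have "\<dots> = Ide C P"
    using add_neg_right[OF ifp] add_zero_left[OF ip] add_commute[OF i'p' ip] sum by simp
  finally have 4: "(((i \<star> f) \<boxplus> i') \<star> p') \<boxplus> (i \<star> (p \<boxplus> neg (f \<star> p'))) = Ide C P" .
  show ?thesis unfolding biproduct_def using X i p e m n 1 2 3 4 by simp
qed

section \<open>Pushing and pulling extensions\<close>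

context biadditive_bifunctor
begin

lemma ext_group: "\<lbrakk>C \<in> Obj B; A \<in> Obj B\<rbrakk> \<Longrightarrow> group (Ext B C A)"
  using ext_comm_group comm_group.axioms(2) by blast

lemma ext_one: "\<lbrakk>C \<in> Obj B; A \<in> Obj B\<rbrakk> \<Longrightarrow> \<one>\<^bsub>Ext B C A\<^esub> \<in> carrier (Ext B C A)"
  using ext_group group.is_monoid monoid.one_closed by blast

lemma push_closed:
  "\<lbrakk>\<delta> \<in> carrier (Ext B C A); f \<in> Hom B A X; C \<in> Obj B\<rbrakk> \<Longrightarrow> push B C f \<delta> \<in> carrier (Ext B C X)"
  unfolding push_def using ext_map_hom[OF ide_in_Hom] by (auto simp: hom_def Pi_def)

lemma pull_closed:
  "\<lbrakk>\<delta> \<in> carrier (Ext B C A); g \<in> Hom B Y C; A \<in> Obj B\<rbrakk> \<Longrightarrow> pull B A g \<delta> \<in> carrier (Ext B Y A)"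
  unfolding pull_def using ext_map_hom[OF _ ide_in_Hom] by (auto simp: hom_def Pi_def)

lemma push_one:
  assumes "f \<in> Hom B A X" "C \<in> Obj B"
  shows "push B C f \<one>\<^bsub>Ext B C A\<^esub> = \<one>\<^bsub>Ext B C X\<^esub>"
  using Hom_Obj[OF assms(1)] assms ext_map_hom[OF ide_in_Hom[OF assms(2)] assms(1)]
    group_hom.hom_one[of "Ext B C A" "Ext B C X"] ext_group
  unfolding push_def group_hom_def group_hom_axioms_def by blast

lemma pull_one:
  assumes "g \<in> Hom B Y C" "A \<in> Obj B"
  shows "pull B A g \<one>\<^bsub>Ext B C A\<^esub> = \<one>\<^bsub>Ext B Y A\<^esub>"
  using Hom_Obj[OF assms(1)] assms ext_map_hom[OF assms(1) ide_in_Hom[OF assms(2)]]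
    group_hom.hom_one[of "Ext B C A" "Ext B Y A"] ext_group
  unfolding pull_def group_hom_def group_hom_axioms_def by blast

lemma push_ide: "\<lbrakk>\<delta> \<in> carrier (Ext B C A); C \<in> Obj B; A \<in> Obj B\<rbrakk> \<Longrightarrow> push B C (Ide B A) \<delta> = \<delta>"
  unfolding push_def using ext_map_ide by blast

lemma pull_ide: "\<lbrakk>\<delta> \<in> carrier (Ext B C A); C \<in> Obj B; A \<in> Obj B\<rbrakk> \<Longrightarrow> pull B A (Ide B C) \<delta> = \<delta>"
  unfolding pull_def using ext_map_ide by blast

lemma push_comp:
  assumes "\<delta> \<in> carrier (Ext B C A)" "C \<in> Obj B" "f \<in> Hom B A X" "f' \<in> Hom B X X'"
  shows "push B C (f' \<star> f) \<delta> = push B C f' (push B C f \<delta>)"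
proof -
  note i = ide_in_Hom[OF assms(2)]
  show ?thesis unfolding push_def
    using ext_map_comp[OF i i assms(3,4,1)] comp_ide_left[OF i] by simp
qed

lemma pull_comp:
  assumes "\<delta> \<in> carrier (Ext B C A)" "A \<in> Obj B" "g \<in> Hom B Y C" "g' \<in> Hom B Y' Y"
  shows "pull B A (g \<star> g') \<delta> = pull B A g' (pull B A g \<delta>)"
proof -
  note i = ide_in_Hom[OF assms(2)]
  show ?thesis unfolding pull_def
    using ext_map_comp[OF assms(3,4) i i assms(1)] comp_ide_left[OF i] by simp
qed

lemma push_pull:
  assumes d: "\<delta> \<in> carrier (Ext B C A)" and g: "g \<in> Hom B Y C" and f: "f \<in> Hom B A X"
  shows "push B Y f (pull B A g \<delta>) = pull B X g (push B C f \<delta>)"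
proof -
  have X: "Y \<in> Obj B" "C \<in> Obj B" "A \<in> Obj B" "X \<in> Obj B" using Hom_Obj f g by auto
  show ?thesis unfolding push_def pull_def
    using ext_map_comp[OF g ide_in_Hom[OF X(1)] ide_in_Hom[OF X(3)] f d]
      ext_map_comp[OF ide_in_Hom[OF X(2)] g f ide_in_Hom[OF X(4)] d]
      comp_ide_left[OF g] comp_ide_left[OF f] comp_ide_right[OF g] comp_ide_right[OF f] by simp
qed

end

section \<open>Exactness properties of conflations\<close>

context extriangulated_category
begin

lemma realisedD:
  assumes "realised B \<delta> A a Y b C"
  shows "A \<in> Obj B" "Y \<in> Obj B" "C \<in> Obj B" "\<delta> \<in> carrier (Ext B C A)"
    "a \<in> Hom B A Y" "b \<in> Hom B Y C"
  using assms by (auto simp: realised_def)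

text \<open>The sequences \<open>X = X -> 0\<close> and \<open>0 -> X = X\<close> are the test
  sequences for (ET3) and its dual: comparing a conflation with one of them gives the exactness
  statements below.\<close>

lemma realised_ide:
  assumes "zero_object B Z" "X \<in> Obj B"
  shows "realised B \<one>\<^bsub>Ext B Z X\<^esub> X (Ide B X) X (Zero B X Z) Z"
    "realised B \<one>\<^bsub>Ext B X Z\<^esub> Z (Zero B Z X) X (Ide B X) X"
  using real_zero biproduct_zero_object[OF assms] biproduct_swap by blast+

lemma obtain_realised:
  assumes "\<delta> \<in> carrier (Ext B C A)" "C \<in> Obj B" "A \<in> Obj B"
  obtains a Y b where "realised B \<delta> A a Y b C"
proof -
  obtain a b where "(a, b) \<in> seqs B A C" "Realise B C A \<delta> = seq_equiv B A C `` {(a, b)}"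
    using real_class[OF assms(2,3,1)] by (auto elim!: quotientE)
  then show ?thesis using that assms by (auto simp: realised_def seqs_def)
qed

lemma realised_unique:
  assumes r: "realised B \<delta> A a Y b C" and r': "realised B \<delta> A a' Y' b' C"
  obtains g where "g \<in> Hom B Y Y'" "isomorphism B g"
proof -
  note d = realisedD[OF r] and d' = realisedD[OF r']
  note i = ide_in_Hom[OF d'(2)]
  have "isomorphism B (Ide B Y')" using isomorphismI[OF i i] comp_ide_left[OF i] by simp
  then have "((a', b'), (a', b')) \<in> seq_equiv B A C"
    using d' i comp_ide_left[OF d'(5)] comp_ide_right[OF d'(6)] Hom_D[OF d'(5)]
    by (auto simp: seq_equiv_def seqs_def)
  then have "(a', b') \<in> seq_equiv B A C `` {(a, b)}" using r r' by (auto simp: realised_def)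
  then show ?thesis using that Hom_D[OF d(5)] Hom_D[OF d'(5)] by (auto simp: seq_equiv_def)
qed

lemma obtain_zero_object: obtains Z where "zero_object B Z" "Z \<in> Obj B"
  using has_zero_object by (auto simp: zero_object_def)

text \<open>(ET3) compares \<open>A = A -> 0\<close> with the conflation, with \<open>a\<close> in
  the middle. Then \<open>b \<star> a\<close> factors through the zero object.\<close>

lemma realised_comp_zero:
  assumes r: "realised B \<delta> A a Y b C"
  shows "b \<star> a = Zero B A C"
proof -
  note d = realisedD[OF r]
  obtain Z where Z: "zero_object B Z" "Z \<in> Obj B" by (rule obtain_zero_object)
  obtain h where "h \<in> Hom B Z C" "h \<star> Zero B A Z = b \<star> a"
    using ET3[OF realised_ide(1)[OF Z(1) d(1)] r ide_in_Hom[OF d(1)] d(5)] by auto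
  then show ?thesis using comp_zero_right[OF d(1)] by metis
qed

text \<open>(ET3) maps the conflation to \<open>Y = Y -> 0\<close> with \<open>a\<close> on the
  left, so the pushed class is a pullback of the zero class.\<close>

lemma realised_push_self:
  assumes r: "realised B \<delta> A a Y b C"
  shows "push B C a \<delta> = \<one>\<^bsub>Ext B C Y\<^esub>"
proof -
  note d = realisedD[OF r]
  obtain Z where Z: "zero_object B Z" "Z \<in> Obj B" by (rule obtain_zero_object)
  obtain h where "h \<in> Hom B C Z" "push B C a \<delta> = pull B Y h \<one>\<^bsub>Ext B Z Y\<^esub>"
    using ET3[OF r realised_ide(1)[OF Z(1) d(2)] d(5) ide_in_Hom[OF d(2)]] by auto
  then show ?thesis using pull_one d(2) by metis
qed

lemma realised_pull_self:
  assumes r: "realised B \<delta> A a Y b C"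
  shows "pull B A b \<delta> = \<one>\<^bsub>Ext B Y A\<^esub>"
proof -
  note d = realisedD[OF r]
  obtain Z where Z: "zero_object B Z" "Z \<in> Obj B" by (rule obtain_zero_object)
  obtain h where "h \<in> Hom B Z A" "push B Y h \<one>\<^bsub>Ext B Y Z\<^esub> = pull B A b \<delta>"
    using ET3_op[OF realised_ide(2)[OF Z(1) d(2)] r ide_in_Hom[OF d(2)] d(6)] by auto
  then show ?thesis using push_one d(2) by metis
qed

text \<open>The dual of (ET3) is applied to \<open>X = X -> 0\<close> and the conflation, with
  \<open>f\<close> in the middle; the left component is the factorisation. It need not be unique,
  since \<open>a\<close> need not be monic.\<close>

lemma realised_weak_kernel:
  assumes r: "realised B \<delta> A a Y b C" and f: "f \<in> Hom B X Y" "b \<star> f = Zero B X C"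
  obtains u where "u \<in> Hom B X A" "f = a \<star> u"
proof -
  note d = realisedD[OF r]
  have X: "X \<in> Obj B" using Hom_Obj f by blast
  obtain Z where Z: "zero_object B Z" "Z \<in> Obj B" by (rule obtain_zero_object)
  have "Zero B Z C \<star> Zero B X Z = b \<star> f"
    using comp_zero_right[OF X zero_in_Hom[OF Z(2) d(3)]] f(2) by simp
  then obtain u where "u \<in> Hom B X A" "f \<star> Ide B X = a \<star> u"
    using ET3_op[OF realised_ide(1)[OF Z(1) X] r f(1) zero_in_Hom[OF Z(2) d(3)]] by auto
  then show ?thesis using that comp_ide_right[OF f(1)] by simp
qed

text \<open>When the pulled class vanishes, \<open>g\<close> is the right half of a morphism of
  extensions that starts at the split sequence on \<open>A\<close> and \<open>X\<close>. The middle
  component, restricted to \<open>X\<close>, is the lift.\<close>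

lemma realised_lift:
  assumes r: "realised B \<delta> A a Y b C" and g: "g \<in> Hom B X C" "pull B A g \<delta> = \<one>\<^bsub>Ext B X A\<^esub>"
  obtains u where "u \<in> Hom B X Y" "b \<star> u = g"
proof -
  note d = realisedD[OF r]
  have X: "X \<in> Obj B" using Hom_Obj g by blast
  obtain P i i' p p' where bi: "biproduct B A X P i i' p p'" using has_biproducts[OF d(1) X] by blast
  then have bH: "i' \<in> Hom B X P" "p' \<in> Hom B P X" "p' \<star> i' = Ide B X" by (auto simp: biproduct_def)
  obtain G where G: "G \<in> Hom B P Y" "b \<star> G = g \<star> p'"
    using real_morphism[OF real_zero[OF bi] r ide_in_Hom[OF d(1)] g(1)] g(2)
      push_one[OF ide_in_Hom[OF d(1)] X] by auto
  have "b \<star> (G \<star> i') = g"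
    using comp_assoc[OF bH(1) G(1) d(6)] G(2) comp_assoc[OF bH(1,2) g(1)] bH(3) comp_ide_right[OF g(1)]
    by simp
  then show ?thesis using that comp_in_Hom[OF bH(1) G(1)] by blast
qed

lemma realised_extend:
  assumes r: "realised B \<delta> A a Y b C" and f: "f \<in> Hom B A X" "push B C f \<delta> = \<one>\<^bsub>Ext B C X\<^esub>"
  obtains u where "u \<in> Hom B Y X" "u \<star> a = f"
proof -
  note d = realisedD[OF r]
  have X: "X \<in> Obj B" using Hom_Obj f by blast
  obtain P i i' p p' where bi: "biproduct B X C P i i' p p'" using has_biproducts[OF X d(3)] by blast
  then have bH: "i \<in> Hom B X P" "p \<in> Hom B P X" "p \<star> i = Ide B X" by (auto simp: biproduct_def)
  obtain G where G: "G \<in> Hom B Y P" "G \<star> a = i \<star> f"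
    using real_morphism[OF r real_zero[OF bi] f(1) ide_in_Hom[OF d(3)]] f(2)
      pull_one[OF ide_in_Hom[OF d(3)] X] by auto
  have "(p \<star> G) \<star> a = f"
    using comp_assoc[OF d(5) G(1) bH(2)] G(2) comp_assoc[OF f(1) bH(1,2)] bH(3) comp_ide_left[OF f(1)]
    by simp
  then show ?thesis using that comp_in_Hom[OF G(1) bH(2)] by blast
qed

text \<open>The zero class is also realised by the split sequence, so \<open>Y\<close> is isomorphic
  to a direct sum of \<open>A\<close> and \<open>C\<close>.\<close>

lemma realised_one_summands:
  assumes r: "realised B \<one>\<^bsub>Ext B C A\<^esub> A a Y b C" and Y: "Y \<in> W"
    and W: "additive_subcategory B W" "summand_closed B W"
  shows "A \<in> W" "C \<in> W"
proof -
  note d = realisedD[OF r]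
  obtain P i i' p p' where bi: "biproduct B A C P i i' p p'" using has_biproducts[OF d(1,3)] by blast
  obtain g where "g \<in> Hom B Y P" "isomorphism B g" using realised_unique[OF r real_zero[OF bi]] .
  then have "P \<in> W" using W(1) Y Hom_D[of g] unfolding additive_subcategory_def iso_closed_def by metis
  then show "A \<in> W" "C \<in> W" using bi W(2) unfolding summand_closed_def by blast+
qed

text \<open>The identity of \<open>P\<close> lifts to a section of the deflation. Any class is then
  its own pullback along deflation after section, and the pullback along the deflation is already
  zero.\<close>

lemma projective_ext:
  assumes P: "projective B P" and A: "A \<in> Obj B"
  shows "carrier (Ext B P A) = {\<one>\<^bsub>Ext B P A\<^esub>}"
proof -
  have PO: "P \<in> Obj B" using P by (simp add: projective_def)
  have "\<delta> = \<one>\<^bsub>Ext B P A\<^esub>" if dc: "\<delta> \<in> carrier (Ext B P A)" for \<delta>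
  proof -
    obtain a Y b where r: "realised B \<delta> A a Y b P" using obtain_realised[OF dc PO A] .
    note d = realisedD[OF r]
    obtain s where s: "s \<in> Hom B P Y" "b \<star> s = Ide B P"
      using P r dc ide_in_Hom[OF PO] unfolding projective_def conflation_def by blast
    show ?thesis
      using pull_comp[OF dc A d(6) s(1)] s(2) pull_ide[OF dc PO A] realised_pull_self[OF r]
        pull_one[OF s(1) A] by simp
  qed
  then show ?thesis using ext_one[OF PO A] by blast
qed

text \<open>
  The morphism $X \to Y \oplus I$ is the split inflation $X \to Y \oplus X$ given by the graph of
  \<open>f\<close>, followed by the inflation $\mathrm{id}_Y \oplus x$.
\<close>

lemma inflation_into_biproduct:
  assumes r: "realised B \<delta> X x I y S" and f: "f \<in> Hom B X Y" and Q: "biproduct B Y I Q j j' q q'"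
  obtains C \<zeta> c where "realised B \<zeta> X ((j \<star> f) \<boxplus> (j' \<star> x)) Q c C"
proof -
  note d = realisedD[OF r]
  have Y: "Y \<in> Obj B" using f Hom_Obj by blast
  obtain Z where Z: "zero_object B Z" "Z \<in> Obj B" by (rule obtain_zero_object)
  obtain P i i' p p' where P: "biproduct B Y X P i i' p p'" using has_biproducts[OF Y d(1)] by blast
  from P have i: "i \<in> Hom B Y P" "i' \<in> Hom B X P" and p: "p \<in> Hom B P Y" "p' \<in> Hom B P X"
    and e: "p \<star> i = Ide B Y" "p' \<star> i' = Ide B X" "p \<star> i' = Zero B X Y" "p' \<star> i = Zero B Y X"
    by (auto simp: biproduct_def)
  from Q have j: "j \<in> Hom B Y Q" "j' \<in> Hom B I Q" by (auto simp: biproduct_def)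
  define m where "m = (i \<star> f) \<boxplus> i'"
  have bm: "biproduct B X Y P m i p' (p \<boxplus> neg (f \<star> p'))"
    unfolding m_def by (rule biproduct_shear[OF P f])
  then have m: "m \<in> Hom B X P" by (simp add: biproduct_def)
  define n where "n = (j \<star> Ide B Y \<star> p) \<boxplus> (j' \<star> x \<star> p')"
  \<comment> \<open>The identity of \<open>Y\<close> is an inflation with cone 0. Its sum with
    \<open>x\<close> is an inflation whose cone is the direct sum of 0 and \<open>S\<close>, taken
    to be \<open>S\<close> itself.\<close>
  have "\<exists>\<theta> b. realised B \<theta> P n Q b S"
    unfolding n_def
    using real_sum[OF realised_ide(1)[OF Z(1) Y] r P Q biproduct_swap[OF biproduct_zero_object[OF Z(1) d(3)]]]
    by blast
  then obtain \<theta> b where \<theta>: "realised B \<theta> P n Q b S" by blast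
  note if' = comp_in_Hom[OF f i(1)] and jx = comp_in_Hom[OF d(5) j(2)]
  note jp = comp_in_Hom[OF p(1) j(1)] and jxp = comp_in_Hom[OF p(2) jx]
  have n: "n = (j \<star> p) \<boxplus> ((j' \<star> x) \<star> p')" by (simp add: n_def comp_ide_right[OF j(1)])
  have pm: "p \<star> m = f"
    using comp_add_right[OF if' i(2) p(1)] comp_assoc[OF f i(1) p(1)] e comp_ide_left[OF f]
      add_zero_right[OF f] by (simp add: m_def)
  have p'm: "p' \<star> m = Ide B X" using bm by (simp add: biproduct_def)
  have "n \<star> m = (j \<star> f) \<boxplus> (j' \<star> x)"
    using comp_add_left[OF m jp jxp] comp_assoc[OF m p(1) j(1)] comp_assoc[OF m p(2) jx] pm p'm
      comp_ide_right[OF jx] by (simp add: n)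
  \<comment> \<open>(ET4) composes the two inflations; of its output only the composite conflation
    is kept.\<close>
  then show ?thesis using that ET4[OF real_zero[OF bm] \<theta>] by metis
qed

end

section \<open>Twin cotorsion pairs with T = U\<close>

lemma ext_vanishesD:
  "\<lbrakk>ext_vanishes B \<X> \<Y>; X \<in> \<X>; Y \<in> \<Y>; \<delta> \<in> carrier (Ext B X Y)\<rbrakk> \<Longrightarrow> \<delta> = \<one>\<^bsub>Ext B X Y\<^esub>"
  by (auto simp: ext_vanishes_def)

lemma additive_subcategory_Obj: "\<lbrakk>additive_subcategory B W; X \<in> W\<rbrakk> \<Longrightarrow> X \<in> Obj B"
  unfolding additive_subcategory_def iso_closed_def by blast

locale twin_cotorsion_T_eq_U = extriangulated_category B
  for B :: "('o, 'm, 'e) extriangulated" (structure) +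
  fixes S T V :: "'o set"
  assumes twin: "twin_cotorsion_pair B S T T V"
    and projectives: "enough_projectives B"
begin

abbreviation K where "K \<equiv> CoCone B S S"

abbreviation idT where "idT \<equiv> factoring_ideal B T"

lemma subcategories:
  "additive_subcategory B S" "summand_closed B S" "additive_subcategory B T" "summand_closed B T"
  using twin unfolding twin_cotorsion_pair_def cotorsion_pair_def by blast+

lemma ext_S_T: "ext_vanishes B S T" and ext_S_V: "ext_vanishes B S V"
  using twin unfolding twin_cotorsion_pair_def cotorsion_pair_def by blast+

lemma Obj_eq: "Cone B T S = Obj B" "CoCone B T S = Obj B" "Cone B V T = Obj B"
  using twin unfolding twin_cotorsion_pair_def cotorsion_pair_def by blast+

lemma obtain_S_cover:
  assumes "X \<in> Obj B"
  obtains \<delta> T' a S' b where "T' \<in> T" "S' \<in> S" "realised B \<delta> T' a S' b X"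
  using assms unfolding Obj_eq(1)[symmetric] Cone_def conflation_def by blast

lemma obtain_T_envelope:
  assumes "X \<in> Obj B"
  obtains \<delta> T' a S' b where "T' \<in> T" "S' \<in> S" "realised B \<delta> X a T' b S'"
  using assms unfolding Obj_eq(2)[symmetric] CoCone_def conflation_def by blast

lemma obtain_T_cover:
  assumes "X \<in> Obj B"
  obtains \<delta> V' a T' b where "V' \<in> V" "T' \<in> T" "realised B \<delta> V' a T' b X"
  using assms unfolding Obj_eq(3)[symmetric] Cone_def conflation_def by blast

text \<open>The conflation \<open>V' -> T' -> s\<close> from the pair (T, V) splits because E(S, V)
  = 0, so \<open>s\<close> is a summand of \<open>T'\<close>.\<close>

lemma S_subset_T: "S \<subseteq> T"
proof
  fix s assume s: "s \<in> S"
  have sO: "s \<in> Obj B" using s by (rule additive_subcategory_Obj[OF subcategories(1)])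
  obtain \<delta> V' a T' b where r: "V' \<in> V" "T' \<in> T" "realised B \<delta> V' a T' b s"
    using obtain_T_cover[OF sO] .
  have "\<delta> = \<one>\<^bsub>Ext B s V'\<^esub>"
    using ext_vanishesD[OF ext_S_V s r(1)] realisedD(4)[OF r(3)] by blast
  then show "s \<in> T" using realised_one_summands(2)[OF _ r(2) subcategories(3,4)] r(3) by simp
qed

text \<open>All classes on a projective vanish, so the conflation \<open>T' -> S' -> P\<close>
  splits.\<close>

lemma projective_in_S:
  assumes "projective B P"
  shows "P \<in> S"
proof -
  have P: "P \<in> Obj B" using assms by (simp add: projective_def)
  obtain \<delta> T' a S' b where r: "T' \<in> T" "S' \<in> S" "realised B \<delta> T' a S' b P"
    using obtain_S_cover[OF P] .
  then have "\<delta> = \<one>\<^bsub>Ext B P T'\<^esub>" using projective_ext[OF assms] realisedD[OF r(3)] by blast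
  then show ?thesis using realised_one_summands(2)[OF _ r(2) subcategories(1,2)] r(3) by simp
qed

text \<open>A conflation \<open>P -> T0 -> S0\<close> is enough if its class is zero, for then
  \<open>P\<close> is a summand of \<open>T0\<close>. (ET4) ties this class to E(S0, T1) and E(S0,
  T2), both zero, and so does the work of an exact sequence E(S0, T1) -> E(S0, P) -> E(S0,
  T2).\<close>

lemma T_extension_closed:
  assumes r: "realised B \<delta> T1 a P b T2" and T12: "T1 \<in> T" "T2 \<in> T"
  shows "P \<in> T"
proof -
  note d = realisedD[OF r]
  obtain \<delta>' T0 c S0 c' where r': "T0 \<in> T" "S0 \<in> S" "realised B \<delta>' P c T0 c' S0"
    using obtain_T_envelope[OF d(2)] .
  note d' = realisedD[OF r'(3)]
  obtain E \<delta>'' d1 e where E: "E \<in> Obj B" "\<delta>'' \<in> carrier (Ext B E T1)" "d1 \<in> Hom B T2 E" "e \<in> Hom B E S0"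
    and re: "realised B (push B S0 b \<delta>') T2 d1 E e S0"
    and eq: "push B E a \<delta>'' = pull B P e \<delta>'"
    using ET4[OF r r'(3)] by blast
  have "push B S0 b \<delta>' = \<one>\<^bsub>Ext B S0 T2\<^esub>"
    using ext_vanishesD[OF ext_S_T r'(2) T12(2)] realisedD(4)[OF re] by blast
  then have "pull B T2 (Ide B S0) (push B S0 b \<delta>') = \<one>\<^bsub>Ext B S0 T2\<^esub>"
    using pull_one[OF ide_in_Hom[OF d'(3)] d(3)] by simp
  then obtain s where s: "s \<in> Hom B S0 E" "e \<star> s = Ide B S0"
    using realised_lift[OF re ide_in_Hom[OF d'(3)]] by blast
  \<comment> \<open>As \<open>s\<close> is a section of \<open>e\<close>, the class
    \<open>\<delta>'\<close> is recovered by pulling back along \<open>e\<close> and then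
    \<open>s\<close>; by \<open>eq\<close> the first pullback is pushed from
    \<open>T1\<close>.\<close>
  have "pull B T1 s \<delta>'' = \<one>\<^bsub>Ext B S0 T1\<^esub>"
    using ext_vanishesD[OF ext_S_T r'(2) T12(1)] pull_closed[OF E(2) s(1) d(1)] by blast
  then have "pull B P s (push B E a \<delta>'') = \<one>\<^bsub>Ext B S0 P\<^esub>"
    using push_pull[OF E(2) s(1) d(5)] push_one[OF d(5) d'(3)] by simp
  then have "\<delta>' = \<one>\<^bsub>Ext B S0 P\<^esub>"
    using pull_comp[OF d'(4) d(2) E(4) s(1)] s(2) eq pull_ide[OF d'(4) d'(3) d'(1)] by simp
  then show ?thesis using realised_one_summands(1)[OF _ r'(1) subcategories(3,4)] r'(3) by simp
qed

section \<open>Objects of CoCone(S, S) and their covering property\<close>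

lemma K_subset_Obj: "K \<subseteq> Obj B"
  using realisedD(1) by (fastforce simp: CoCone_def conflation_def)

text \<open>The obstruction to extending a morphism from \<open>X\<close> to an object of T along
  \<open>k\<close> lies in E(S1, T). The factorisation is through the given \<open>k\<close>, not
  merely through some object of S, and the later arguments rely on that.\<close>

lemma factor_through_S:
  assumes r: "realised B \<sigma> X k S0 l S1" and S: "S0 \<in> S" "S1 \<in> S" and f: "f \<in> idT X Y"
  obtains v where "v \<in> Hom B S0 Y" "f = v \<star> k"
proof -
  note d = realisedD[OF r]
  obtain p q T' where f': "T' \<in> T" "p \<in> Hom B X T'" "q \<in> Hom B T' Y" "f = q \<star> p"
    using f factoring_idealE by metis
  have "push B S1 p \<sigma> = \<one>\<^bsub>Ext B S1 T'\<^esub>"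
    using ext_vanishesD[OF ext_S_T S(2) f'(1)] push_closed[OF d(4) f'(2) d(3)] by blast
  then obtain u where u: "u \<in> Hom B S0 T'" "u \<star> k = p" using realised_extend[OF r f'(2)] by blast
  then show ?thesis
    using that[OF comp_in_Hom[OF u(1) f'(3)]] comp_assoc[OF d(5) u(1) f'(3)] f'(4) by simp
qed

lemma obtain_K:
  assumes "X \<in> K"
  obtains \<sigma> S0 S1 k l where "S0 \<in> S" "S1 \<in> S" "realised B \<sigma> X k S0 l S1"
  using assms by (auto simp: CoCone_def conflation_def)

lemma factoring_ideal_K:
  assumes "X \<in> K"
  shows "factoring_ideal B S X Y = factoring_ideal B T X Y"
proof (intro equalityI subsetI)
  fix f assume "f \<in> factoring_ideal B S X Y"
  then show "f \<in> idT X Y" using S_subset_T by (auto simp: factoring_ideal_def)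
next
  fix f assume f: "f \<in> idT X Y"
  obtain \<sigma> S0 S1 k l where r: "S0 \<in> S" "S1 \<in> S" "realised B \<sigma> X k S0 l S1"
    using obtain_K[OF assms] .
  then show "f \<in> factoring_ideal B S X Y"
    using factor_through_S[OF r(3,1,2) f] factoring_idealI[OF r(1) realisedD(5)[OF r(3)]] by metis
qed

text \<open>Epic half: if \<open>f \<star> d\<close> is in [T], it factors through
  \<open>c'\<close>, the inflation of \<open>E -> S1 -> S0\<close>, and pushing along
  \<open>c'\<close> kills the class of that conflation. Hence pushing along \<open>f\<close> kills
  \<open>\<delta>\<close>, and \<open>f\<close> extends to \<open>T0\<close>.

  Monic half: if \<open>d \<star> u\<close> passes through \<open>T2\<close>, then \<open>u\<close>
  is, up to a morphism through \<open>T1\<close>, a morphism through an extension of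
  \<open>T2\<close> by \<open>T1\<close>, which lies in T.\<close>

lemma obtain_K_cover:
  assumes X: "X \<in> Obj B"
  obtains E d where "E \<in> K" "d \<in> Hom B E X"
    "\<And>Y u. u \<in> Hom B Y E \<Longrightarrow> d \<star> u \<in> idT Y X \<Longrightarrow> u \<in> idT Y E"
    "\<And>Y f. f \<in> Hom B X Y \<Longrightarrow> f \<star> d \<in> idT E Y \<Longrightarrow> f \<in> idT X Y"
proof -
  obtain \<delta> T0 x S0 y where r0: "T0 \<in> T" "S0 \<in> S" "realised B \<delta> X x T0 y S0"
    using obtain_T_envelope[OF X] .
  note d0 = realisedD[OF r0(3)]
  obtain \<delta>' T1 t S1 s where r1: "T1 \<in> T" "S1 \<in> S" "realised B \<delta>' T1 t S1 s T0"
    using obtain_S_cover[OF d0(2)] .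
  note d1 = realisedD[OF r1(3)]
  obtain E \<delta>'' c c' d e where H: "\<delta>'' \<in> carrier (Ext B S0 E)" "c' \<in> Hom B E S1" "d \<in> Hom B E X"
      "e \<in> Hom B T1 E"
    and rE: "realised B \<delta>'' E c' S1 c S0"
    and rX: "realised B (pull B T1 x \<delta>') T1 e E d X"
    and push: "push B S0 d \<delta>'' = \<delta>"
    using ET4_op[OF r0(3) r1(3)] by blast
  have EK: "E \<in> K" unfolding CoCone_def conflation_def using rE H(1) r1(2) r0(2) by blast
  note dX = realisedD[OF rX]
  show ?thesis
  proof (rule that[OF EK H(3)])
    fix Y f assume f: "f \<in> Hom B X Y" and fd: "f \<star> d \<in> idT E Y"
    obtain h where h: "h \<in> Hom B S1 Y" "f \<star> d = h \<star> c'"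
      using factor_through_S[OF rE r1(2) r0(2) fd] .
    have "push B S0 f \<delta> = push B S0 (h \<star> c') \<delta>''"
      using push_comp[OF H(1) d0(3) H(3) f] push h(2) by simp
    also have "\<dots> = \<one>\<^bsub>Ext B S0 Y\<^esub>"
      using push_comp[OF H(1) d0(3) H(2) h(1)] realised_push_self[OF rE] push_one[OF h(1) d0(3)] by simp
    finally obtain u where "u \<in> Hom B T0 Y" "u \<star> x = f" using realised_extend[OF r0(3) f] by blast
    then show "f \<in> idT X Y" using factoring_idealI[OF r0(1) d0(5)] by blast
  next
    fix Y u assume u: "u \<in> Hom B Y E" and du: "d \<star> u \<in> idT Y X"
    obtain w v T2 where wv: "T2 \<in> T" "w \<in> Hom B Y T2" "v \<in> Hom B T2 X" "d \<star> u = v \<star> w"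
      using du factoring_idealE by metis
    have T2: "T2 \<in> Obj B" "Y \<in> Obj B" using wv Hom_Obj by auto
    define \<epsilon> where "\<epsilon> = pull B T1 x \<delta>'"
    note rX = rX[folded \<epsilon>_def] and dX = dX[folded \<epsilon>_def]
    have v\<epsilon>: "pull B T1 v \<epsilon> \<in> carrier (Ext B T2 T1)" by (rule pull_closed[OF dX(4) wv(3) dX(1)])
    \<comment> \<open>The realisation of the pulled class stands in for a pullback of
      \<open>d\<close> along \<open>v\<close>.\<close>
    obtain p P q where rP: "realised B (pull B T1 v \<epsilon>) T1 p P q T2"
      using obtain_realised[OF v\<epsilon> T2(1) dX(1)] .
    note dP = realisedD[OF rP]
    have PT: "P \<in> T" by (rule T_extension_closed[OF rP r1(1) wv(1)])
    have "pull B T1 w (pull B T1 v \<epsilon>) = pull B T1 (d \<star> u) \<epsilon>"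
      using pull_comp[OF dX(4) dX(1) wv(3,2)] wv(4) by simp
    also have "\<dots> = \<one>\<^bsub>Ext B Y T1\<^esub>"
      using pull_comp[OF dX(4) dX(1) H(3) u] realised_pull_self[OF rX] pull_one[OF u dX(1)] by simp
    finally obtain w' where w': "w' \<in> Hom B Y P" "q \<star> w' = w"
      using realised_lift[OF rP wv(2)] by blast
    have "push B T2 (Ide B T1) (pull B T1 v \<epsilon>) = pull B T1 v \<epsilon>"
      by (rule push_ide[OF v\<epsilon> T2(1) dX(1)])
    then obtain \<phi> where \<phi>: "\<phi> \<in> Hom B P E" "d \<star> \<phi> = v \<star> q"
      using real_morphism[OF rP rX ide_in_Hom[OF dX(1)] wv(3)] by blast
    note \<phi>w = comp_in_Hom[OF w'(1) \<phi>(1)]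
    \<comment> \<open>The part through \<open>P\<close> agrees with \<open>u\<close> after
      \<open>d\<close>, so their difference comes from \<open>T1\<close>.\<close>
    have "d \<star> (\<phi> \<star> w') = d \<star> u"
      using comp_assoc[OF w'(1) \<phi>(1) H(3)] \<phi>(2) comp_assoc[OF w'(1) dP(6) wv(3)] w'(2) wv(4) by simp
    then have "d \<star> (u \<boxplus> neg (\<phi> \<star> w')) = Zero B Y X"
      using comp_diff_right[OF u \<phi>w H(3)] add_neg_right[OF comp_in_Hom[OF u H(3)]] by simp
    then obtain z where z: "z \<in> Hom B Y T1" "u \<boxplus> neg (\<phi> \<star> w') = e \<star> z"
      using realised_weak_kernel[OF rX add_in_Hom[OF u neg_in_Hom[OF \<phi>w]]] by blast
    have "u = (e \<star> z) \<boxplus> (\<phi> \<star> w')" using diff_add_cancel[OF u \<phi>w] z(2) by simp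
    then show "u \<in> idT Y E"
      using factoring_ideal_add[OF subcategories(3) factoring_idealI[OF r1(1) z(1) H(4)]
          factoring_idealI[OF PT w'(1) \<phi>(1)]] by simp
  qed
qed

text \<open>
  Replace \<open>f\<close> by an inflation $F : X \to Y \oplus T_0$ with cone \<open>C\<close> and class $\zeta$. That \<open>f\<close> is
  epic puts $Y \oplus T_0 \to C$ into $[T]$. That \<open>f\<close> is monic, applied to the morphism from the
  kernel of a projective cover of \<open>C\<close>, shows that $\zeta$ is pushed out from an object of \<open>T\<close>; hence
  every morphism from \<open>S\<close> to \<open>C\<close> lifts along $Y \oplus T_0 \to C$.
\<close>

lemma regular_lift:
  assumes f: "f \<in> Hom B X Y"
    and mono: "\<And>Z u. u \<in> Hom B Z X \<Longrightarrow> f \<star> u \<in> idT Z Y \<Longrightarrow> u \<in> idT Z X"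
    and epi: "\<And>Z u. u \<in> Hom B Y Z \<Longrightarrow> u \<star> f \<in> idT X Z \<Longrightarrow> u \<in> idT Y Z"
    and W: "W \<in> K" and g: "g \<in> Hom B W Y"
  obtains u t where "u \<in> Hom B W X" "t \<in> idT W Y" "g = t \<boxplus> (f \<star> u)"
proof -
  have X: "X \<in> Obj B" "Y \<in> Obj B" using Hom_Obj f by auto
  obtain \<sigma> S0 S1 k l where K: "S0 \<in> S" "S1 \<in> S" "realised B \<sigma> W k S0 l S1"
    using obtain_K[OF W] .
  note dK = realisedD[OF K(3)]
  obtain \<delta> T0 x S2 y where r0: "T0 \<in> T" "S2 \<in> S" "realised B \<delta> X x T0 y S2"
    using obtain_T_envelope[OF X(1)] .
  note d0 = realisedD[OF r0(3)]
  obtain Q j j' q q' where bi: "biproduct B Y T0 Q j j' q q'" using has_biproducts[OF X(2) d0(2)] by blast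
  then have j: "j \<in> Hom B Y Q" "j' \<in> Hom B T0 Q" and q: "q \<in> Hom B Q Y" "q' \<in> Hom B Q T0"
    and e: "q \<star> j = Ide B Y" "q \<star> j' = Zero B T0 Y"
    and sum: "(j \<star> q) \<boxplus> (j' \<star> q') = Ide B Q"
    by (auto simp: biproduct_def)
  \<comment> \<open>The added component passes through \<open>T0\<close>, which is zero modulo [T];
    so in the quotient \<open>F\<close> still represents \<open>f\<close>.\<close>
  define F where "F = (j \<star> f) \<boxplus> (j' \<star> x)"
  obtain C \<zeta> c where rF: "realised B \<zeta> X F Q c C"
    using inflation_into_biproduct[OF r0(3) f bi] unfolding F_def by blast
  note dF = realisedD[OF rF]
  note jf = comp_in_Hom[OF f j(1)] and jx = comp_in_Hom[OF d0(5) j(2)]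
  note cj = comp_in_Hom[OF j(1) dF(6)] and cj' = comp_in_Hom[OF j(2) dF(6)]
  have qF: "q \<star> F = f"
    using comp_add_right[OF jf jx q(1)] comp_assoc[OF f j(1) q(1)] comp_assoc[OF d0(5) j(2) q(1)] e
      comp_ide_left[OF f] comp_zero_left[OF X(2) d0(5)] add_zero_right[OF f] by (simp add: F_def)
  \<comment> \<open>In the relation \<open>c \<star> F = 0\<close> the part through
    \<open>T0\<close> lies in [T], hence so does the other part, and epicity cancels
    \<open>f\<close> from it.\<close>
  have "((c \<star> j) \<star> f) \<boxplus> ((c \<star> j') \<star> x) = Zero B X C"
    using realised_comp_zero[OF rF] comp_add_right[OF jf jx dF(6)] comp_assoc[OF f j(1) dF(6)]
      comp_assoc[OF d0(5) j(2) dF(6)] by (simp add: F_def)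
  then have "(c \<star> j) \<star> f = neg ((c \<star> j') \<star> x)"
    using neg_unique[OF comp_in_Hom[OF f cj] comp_in_Hom[OF d0(5) cj']] by simp
  then have "(c \<star> j) \<star> f \<in> idT X C"
    using factoring_ideal_neg[OF factoring_idealI[OF r0(1) d0(5) cj']] by simp
  then have cjT: "c \<star> j \<in> idT Y C" using epi[OF cj] by blast
  obtain Z z P \<pi> \<rho> where P: "projective B P" "realised B \<rho> Z z P \<pi> C"
    using projectives dF(3) unfolding enough_projectives_def conflation_def by blast
  note dP = realisedD[OF P(2)]
  have PT: "P \<in> T" using projective_in_S[OF P(1)] S_subset_T by blast
  obtain r where r: "r \<in> Hom B P Q" "c \<star> r = \<pi>"
    using P(1) rF dF(4) dP(6) unfolding projective_def conflation_def by blast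
  \<comment> \<open>Passing to kernels exhibits \<open>\<zeta>\<close> as the pushout of
    \<open>\<rho>\<close> along \<open>w\<close>. Monicity applies to \<open>w\<close> because
    \<open>f \<star> w\<close> passes through the projective \<open>P\<close>, an object of
    T.\<close>
  obtain w where w: "w \<in> Hom B Z X" "push B C w \<rho> = pull B X (Ide B C) \<zeta>" "r \<star> z = F \<star> w"
    using ET3_op[OF P(2) rF r(1) ide_in_Hom[OF dF(3)]] comp_ide_left[OF dP(6)] r(2) by auto
  have "f \<star> w = (q \<star> r) \<star> z"
    using comp_assoc[OF w(1) dF(5) q(1)] qF comp_assoc[OF dP(5) r(1) q(1)] w(3) by simp
  then have "f \<star> w \<in> idT Z Y"
    using factoring_idealI[OF PT dP(5) comp_in_Hom[OF r(1) q(1)]] by simp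
  then have "w \<in> idT Z X" using mono[OF w(1)] by blast
  then obtain v1 v2 T' where v: "T' \<in> T" "v1 \<in> Hom B Z T'" "v2 \<in> Hom B T' X" "w = v2 \<star> v1"
    using factoring_idealE by metis
  define \<tau> where "\<tau> = push B C v1 \<rho>"
  have \<tau>: "\<tau> \<in> carrier (Ext B C T')" unfolding \<tau>_def by (rule push_closed[OF dP(4) v(2) dP(3)])
  have \<zeta>: "\<zeta> = push B C v2 \<tau>"
    using w(2) pull_ide[OF dF(4) dF(3) dF(1)] push_comp[OF dP(4) dP(3) v(2,3)] v(4) by (simp add: \<tau>_def)
  have S0_lift: "\<exists>l \<in> Hom B S0 Q. c \<star> l = s" if s: "s \<in> Hom B S0 C" for s
  proof -
    have T': "T' \<in> Obj B" using v(2) Hom_Obj by blast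
    have "pull B T' s \<tau> = \<one>\<^bsub>Ext B S0 T'\<^esub>"
      using ext_vanishesD[OF ext_S_T K(1) v(1)] pull_closed[OF \<tau> s T'] by blast
    then have "pull B X s \<zeta> = \<one>\<^bsub>Ext B S0 X\<^esub>"
      using push_pull[OF \<tau> s v(3)] push_one[OF v(3) dK(2)] \<zeta> by simp
    then show ?thesis using realised_lift[OF rF s] by blast
  qed
  note jg = comp_in_Hom[OF g j(1)]
  \<comment> \<open>\<open>j \<star> g\<close> need not come from \<open>X\<close>, because its
    image in \<open>C\<close> may be nonzero. That image lies in [T], so it factors through
    \<open>k\<close>, and the factor from \<open>S0\<close> lifts to \<open>m\<close>, which gives
    the correction \<open>m \<star> k\<close>.\<close>
  have "(c \<star> j) \<star> g \<in> idT W C" using factoring_ideal_comp_right[OF cjT g] .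
  then obtain s where s: "s \<in> Hom B S0 C" "(c \<star> j) \<star> g = s \<star> k"
    using factor_through_S[OF K(3,1,2)] by blast
  then obtain m where m: "m \<in> Hom B S0 Q" "c \<star> m = s" using S0_lift by blast
  note mk = comp_in_Hom[OF dK(5) m(1)]
  have "c \<star> (j \<star> g) = c \<star> (m \<star> k)"
    using comp_assoc[OF g j(1) dF(6)] comp_assoc[OF dK(5) m(1) dF(6)] m(2) s(2) by simp
  then have "c \<star> ((j \<star> g) \<boxplus> neg (m \<star> k)) = Zero B W C"
    using comp_diff_right[OF jg mk dF(6)] add_neg_right[OF comp_in_Hom[OF mk dF(6)]] by simp
  then obtain u where u: "u \<in> Hom B W X" "(j \<star> g) \<boxplus> neg (m \<star> k) = F \<star> u"
    using realised_weak_kernel[OF rF add_in_Hom[OF jg neg_in_Hom[OF mk]]] by blast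
  note Fu = comp_in_Hom[OF u(1) dF(5)]
  \<comment> \<open>Projecting to \<open>Y\<close> turns \<open>F \<star> u\<close> into
    \<open>f \<star> u\<close> and leaves a correction through \<open>S0\<close>, which is an object
    of T.\<close>
  have "g = q \<star> (j \<star> g)" using comp_assoc[OF g j(1) q(1)] e(1) comp_ide_left[OF g] by simp
  also have "j \<star> g = (F \<star> u) \<boxplus> (m \<star> k)" using diff_add_cancel[OF jg mk] u(2) by simp
  also have "q \<star> \<dots> = (f \<star> u) \<boxplus> ((q \<star> m) \<star> k)"
    using comp_add_right[OF Fu mk q(1)] comp_assoc[OF u(1) dF(5) q(1)] qF
      comp_assoc[OF dK(5) m(1) q(1)] by simp
  also have "\<dots> = ((q \<star> m) \<star> k) \<boxplus> (f \<star> u)"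
    using add_commute[OF comp_in_Hom[OF u(1) f] comp_in_Hom[OF dK(5) comp_in_Hom[OF m(1) q(1)]]] .
  finally have "g = ((q \<star> m) \<star> k) \<boxplus> (f \<star> u)" .
  moreover have "(q \<star> m) \<star> k \<in> idT W Y"
    using factoring_idealI[OF _ dK(5) comp_in_Hom[OF m(1) q(1)]] K(1) S_subset_T by blast
  ultimately show ?thesis using that u(1) by blast
qed

section \<open>The two hearts and their comparison\<close>

lemma heart_twin: "heart B S T T V = additive_quotient B idT"
proof -
  have "heart_objects B S T T V = Obj B" by (simp add: heart_objects_def Obj_eq)
  then show ?thesis by (simp add: heart_def full_subcategory_Obj)
qed

text \<open>In the degenerate pair \<open>W\<close> is the intersection of S and T, which is S, and
  the cone condition holds for all objects because (S, T) is a cotorsion pair.\<close>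

lemma heart_single:
  "cotorsion_heart B S T = additive_quotient (full_subcategory B K) (factoring_ideal B S)"
proof -
  have "T \<inter> S = S" using S_subset_T by blast
  moreover have "K \<inter> Cone B T S = K" unfolding Obj_eq using K_subset_Obj by blast
  ultimately show ?thesis by (simp add: cotorsion_heart_def heart_def heart_objects_def)
qed

sublocale QT: preadditive_quotient B idT
  using preadditive_quotient_factoring_ideal[OF subcategories(3) order_refl]
  by (simp add: full_subcategory_Obj)

sublocale QS: preadditive_quotient "full_subcategory B K" "factoring_ideal B S"
  by (rule preadditive_quotient_factoring_ideal[OF subcategories(1) K_subset_Obj])

text \<open>The two ideals agree on morphisms out of K, so the cosets are equal as sets. This makes
  K/[S] a full subcategory of B/[T] on the nose, as \<open>coreflective_localisation\<close>
  demands.\<close>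

lemma cls_S_eq_cls_T: "\<lbrakk>X \<in> K; Y \<in> K; f \<in> Hom B X Y\<rbrakk> \<Longrightarrow> QS.cls f = QT.cls f"
  using QS.cls_alt[of f X Y] QT.cls_alt[of f X Y] factoring_ideal_K[of X Y]
  by (simp add: Hom_full_subcategory) (simp add: full_subcategory_def)

theorem equivalent_localised_heart:
  "equivalent_categories
    (localisation (heart B S T T V) (regular_morphisms (heart B S T T V))) (cotorsion_heart B S T)"
proof -
  define R where "R = regular_morphisms QT.Q"
  \<comment> \<open>The counit is the class of the deflation from \<open>obtain_K_cover\<close>,
    whose two ideal conditions are regularity in the quotient.\<close>
  have "\<exists>e. e \<in> R \<and> Cod QT.Q e = X \<and> Dom QT.Q e \<in> K" if X: "X \<in> Obj B" for X
    using X
  proof (rule obtain_K_cover)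
    fix E d assume E: "E \<in> K" "d \<in> Hom B E X"
      "\<And>Y u. u \<in> Hom B Y E \<Longrightarrow> d \<star> u \<in> idT Y X \<Longrightarrow> u \<in> idT Y E"
      "\<And>Y f. f \<in> Hom B X Y \<Longrightarrow> f \<star> d \<in> idT E Y \<Longrightarrow> f \<in> idT X Y"
    have "QT.cls d \<in> R"
      unfolding R_def regular_morphisms_def using QT.monomorphism_cls_iff[OF E(2)]
        QT.epimorphism_cls_iff[OF E(2)] E(3,4) by blast
    then show ?thesis using QT.Dom_Cod_Q[OF E(2)] E(1) by blast
  qed
  then obtain \<epsilon> where \<epsilon>: "\<And>X. X \<in> Obj B \<Longrightarrow> \<epsilon> X \<in> R \<and> Cod QT.Q (\<epsilon> X) = X \<and> Dom QT.Q (\<epsilon> X) \<in> K"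
    by metis
  have Q_Hom: "Hom QS.Q X Y = Hom QT.Q X Y" if "X \<in> K" "Y \<in> K" for X Y
    unfolding QS.Hom_Q QT.Hom_Q using that cls_S_eq_cls_T by (auto simp: Hom_full_subcategory)
  interpret coreflective_localisation QT.Q R QS.Q \<epsilon>
  proof (intro coreflective_localisation.intro coreflective_localisation_axioms.intro
      zigzag_category.intro zigzag_category_axioms.intro QT.category_Q QS.category_Q)
    show "R \<subseteq> Arr QT.Q" by (auto simp: R_def regular_morphisms_def monomorphism_def)
    show "Obj QS.Q \<subseteq> Obj QT.Q"
      using K_subset_Obj by (simp add: QS.Q_unfold(1) QT.Q_unfold(1) full_subcategory_simps)
    show "Hom QS.Q X Y = Hom QT.Q X Y" if "X \<in> Obj QS.Q" "Y \<in> Obj QS.Q" for X Y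
      using Q_Hom that by (simp add: QS.Q_unfold(1) full_subcategory_simps)
    show "Ide QS.Q X = Ide QT.Q X" if "X \<in> Obj QS.Q" for X
      using that cls_S_eq_cls_T[of X X "Ide B X"] ide_in_Hom K_subset_Obj
      by (auto simp: QS.Q_unfold(1,5) QT.Q_unfold(5) full_subcategory_simps)
    show "g \<star>\<^bsub>QS.Q\<^esub> f = g \<star>\<^bsub>QT.Q\<^esub> f" if fg: "f \<in> Hom QS.Q X Y" "g \<in> Hom QS.Q Y Z" for f g X Y Z
    proof -
      obtain f' g' where f: "f = QS.cls f'" "f' \<in> Hom (full_subcategory B K) X Y"
        and g: "g = QS.cls g'" "g' \<in> Hom (full_subcategory B K) Y Z"
        using fg unfolding QS.Hom_Q by blast
      from f(2) g(2) have f': "f' \<in> Hom B X Y" and g': "g' \<in> Hom B Y Z" and K: "X \<in> K" "Y \<in> K" "Z \<in> K"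
        by (auto simp: Hom_full_subcategory split: if_splits)
      have "g \<star>\<^bsub>QS.Q\<^esub> f = QS.cls (g' \<star> f')"
        using QS.Comp_Q[OF f(2) g(2)] f(1) g(1) by (simp add: full_subcategory_simps)
      also have "\<dots> = g \<star>\<^bsub>QT.Q\<^esub> f"
        unfolding f(1) g(1) cls_S_eq_cls_T[OF K(1,2) f'] cls_S_eq_cls_T[OF K(2,3) g']
          cls_S_eq_cls_T[OF K(1,3) comp_in_Hom[OF f' g']] QT.Comp_Q[OF f' g'] ..
      finally show ?thesis .
    qed
    show "\<epsilon> X \<in> R \<and> Cod QT.Q (\<epsilon> X) = X \<and> Dom QT.Q (\<epsilon> X) \<in> Obj QS.Q" if "X \<in> Obj QT.Q" for X
      using that \<epsilon> by (simp add: QS.Q_unfold(1) QT.Q_unfold(1) full_subcategory_simps)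
    show "\<exists>!u. u \<in> Hom QT.Q W (Dom QT.Q r) \<and> r \<star>\<^bsub>QT.Q\<^esub> u = g"
      if r: "r \<in> R" and W: "W \<in> Obj QS.Q" and g: "g \<in> Hom QT.Q W (Cod QT.Q r)" for r W g
    proof -
      have mono: "monomorphism QT.Q r" and epi: "epimorphism QT.Q r"
        using r by (auto simp: R_def regular_morphisms_def)
      then have "r \<in> QT.cls ` Arr B" unfolding monomorphism_def QT.Arr_Q by blast
      then obtain f where f: "r = QT.cls f" "f \<in> Hom B (Dom B f) (Cod B f)" by (auto simp: Hom_def)
      define X Y where "X = Dom B f" and "Y = Cod B f"
      have fH: "f \<in> Hom B X Y" using f(2) by (simp add: X_def Y_def)
      have WK: "W \<in> K" using W by (simp add: QS.Q_unfold(1) full_subcategory_simps)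
      note DC = QT.Dom_Cod_Q[OF fH]
      obtain g' where g': "g = QT.cls g'" "g' \<in> Hom B W Y" using g unfolding f(1) DC QT.Hom_Q by blast
      obtain u t where u: "u \<in> Hom B W X" "t \<in> idT W Y" "g' = t \<boxplus> (f \<star> u)"
        using regular_lift[OF fH _ _ WK g'(2)] mono epi
        unfolding f(1) QT.monomorphism_cls_iff[OF fH] QT.epimorphism_cls_iff[OF fH] by blast
      have "QT.cls f \<star>\<^bsub>QT.Q\<^esub> QT.cls u = g"
        using QT.cls_eq_iff[OF g'(2) comp_in_Hom[OF u(1) fH]] u(2,3) g'(1) QT.Comp_Q[OF u(1) fH] by auto
      moreover have "QT.cls u \<in> Hom QT.Q W (Dom QT.Q r)" unfolding QT.Hom_Q f(1) DC using u(1) by blast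
      moreover have "W \<in> Obj QT.Q" using WK K_subset_Obj by (auto simp: QT.Q_unfold(1))
      \<comment> \<open>\<open>regular_lift\<close> has produced a solution; two solutions agree
        because \<open>r\<close> is monic.\<close>
      ultimately show ?thesis using mono f(1) unfolding monomorphism_def by metis
    qed
  qed
  show ?thesis unfolding heart_twin heart_single using equivalent_localisation by (simp add: R_def)
qed

end

theorem theorem5p6:
  fixes B :: "('o, 'm, 'e) extriangulated" and S T U V :: "'o set"
  assumes "extriangulated_category B"
    and "enough_projectives B"
    and "enough_injectives B"
    and "twin_cotorsion_pair B S T U V"
    and "T = U"
  shows "equivalent_categories
           (localisation (heart B S T U V) (regular_morphisms (heart B S T U V)))
           (cotorsion_heart B S T)"
proof -
  interpret twin_cotorsion_T_eq_U B S T V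
    using assms by (simp add: twin_cotorsion_T_eq_U_def twin_cotorsion_T_eq_U_axioms_def)
  show ?thesis using equivalent_localised_heart assms(5) by simp
qed

end
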